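(* Let $b_1,\dots,b_{r+n}$ be a basis of the all-coefficients lattice $L$ that is LLL-reduced (with parameter $3/4$), let $b_1^*,\dots,b_{r+n}^*$ be its Gram–Schmidt orthogonalization, and let $t$ be the smallest index such that $\|b_j^*\|>B'$ for all $j>t$. Let $L'=\mathbb{Z}b_1+\cdots+\mathbb{Z}b_t$. If $$v^{\ell/n}>\|f\|\,(2^{n-1}+n)\,B'\,(1+B'),$$ then the projection of $L'$ onto the first $r$ coordinates equals $W$.
   Context: Let $v$ be a prime number, $\mathbb{Z}_v$ the $v$-adic integers. Let $f\in\mathbb{Z}[X]$ be separable of degree $n\ge2$ with leading coefficient $\ell_f$ not divisible by $v$, and assume $f$ mod $v$ is separable in $\mathbb{F}_v[X]$. Write $f=\ell_f f_1\cdots f_r$ with $f_i\in\mathbb{Z}_v[X]$ monic irreducible over $\mathbb{Q}_v$, and $f=\ell_f g_1\cdots g_s$ with $g_j\in\mathbb{Q}[X]$ monic irreducible. Write $g_j=f_1^{w_{j,1}}\cdots f_r^{w_{j,r}}$ with $w_{j,i}\in\{0,1\}$, $w_j=(w_{j,1},\dots,w_{j,r})^{T}\in\mathbb{Z}^r$, and $W=\mathbb{Z}w_1+\cdots+\mathbb{Z}w_s$. For a polynomial $g$, $\Phi(g)=fg'/g$. Fix an integer $\ell>0$ and integers $a_{i,j}$ ($0\le i\le n-1$, $1\le j\le r$) such that $a_{i,j}$ is congruent modulo $v^\ell\mathbb{Z}_v$ to the coefficient of $X^i$ in $\Phi(f_j)\in\mathbb{Z}_v[X]$. The all-coefficients lattice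 $L\subseteq\mathbb{Z}^{r+n}$ is the lattice spanned by the columns of the $(r+n)\times r$ matrix $\begin{pmatrix}I_r\\ A_1\end{pmatrix}$, $A_1=(a_{i,j})$, together with the vectors $v^\ell e_{r+1},\dots,v^\ell e_{r+n}$ ($e_k$ the standard unit vectors); it has rank $r+n$. $\|\cdot\|$ is the Euclidean ($L^2$) norm on vectors and on coefficient vectors of polynomials. $B=2^{n-1}n\|f\|$ and $B'=\sqrt{r^2+B^2}$. A basis $b_1,\dots,b_m$ with Gram–Schmidt vectors $b_j^*$ and coefficients $\mu_{jk}=\langle b_j,b_k^*\rangle/\langle b_k^*,b_k^*\rangle$ is LLL-reduced with parameter $3/4$ if $|\mu_{jk}|\le 1/2$ for $k<j$ and $\|b_j^*\|^2\ge(3/4-\mu_{j,j-1}^2)\|b_{j-1}^*\|^2$ for $j>1$. *)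

theory Defs
  imports Complex_Main "HOL-Number_Theory.Cong" "Berlekamp_Zassenhaus.Finite_Field"
begin

text \<open>An element of Z_v[X] is represented by a sequence G of integer polynomials, G k being an
approximation modulo v^k. Two such sequences represent the same Z_v-polynomial iff they agree
modulo v^k at every level k.\<close>

definition pcong :: "int \<Rightarrow> int poly \<Rightarrow> int poly \<Rightarrow> bool" where
  "pcong m p q \<longleftrightarrow> (\<forall>i. [coeff p i = coeff q i] (mod m))"

definition zpoly :: "nat \<Rightarrow> (nat \<Rightarrow> int poly) \<Rightarrow> bool" where
  "zpoly v G \<longleftrightarrow> (\<exists>d. \<forall>k. degree (G k) \<le> d) \<and> (\<forall>k. pcong (int v ^ k) (G (Suc k)) (G k))"

definition zeq :: "nat \<Rightarrow> (nat \<Rightarrow> int poly) \<Rightarrow> (nat \<Rightarrow> int poly) \<Rightarrow> bool" where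
  "zeq v G H \<longleftrightarrow> (\<forall>k. pcong (int v ^ k) (G k) (H k))"

definition zp_nonconst :: "nat \<Rightarrow> (nat \<Rightarrow> int poly) \<Rightarrow> bool" where
  "zp_nonconst v G \<longleftrightarrow> (\<exists>j\<ge>1. \<exists>k. \<not> (int v ^ k dvd coeff (G k) j))"

definition zmonic :: "nat \<Rightarrow> (nat \<Rightarrow> int poly) \<Rightarrow> bool" where
  "zmonic v F \<longleftrightarrow> zpoly v F \<and> (\<exists>d. \<forall>k. [coeff (F k) d = 1] (mod int v ^ k)
      \<and> (\<forall>j>d. [coeff (F k) j = 0] (mod int v ^ k)))"

text \<open>Irreducibility in Q_v[X] of a Z_v-polynomial F: F is nonconstant and there is no factorization
F = g h with g, h in Q_v[X] nonconstant; clearing denominators (Q_v = Z_v[1/v]) such a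
factorization is the same as v^m F = G H with G, H in Z_v[X] nonconstant.\<close>
definition irred_Qv :: "nat \<Rightarrow> (nat \<Rightarrow> int poly) \<Rightarrow> bool" where
  "irred_Qv v F \<longleftrightarrow> zp_nonconst v F \<and>
     \<not> (\<exists>m G H. zpoly v G \<and> zpoly v H \<and> zp_nonconst v G \<and> zp_nonconst v H \<and>
           zeq v (\<lambda>k. smult (int v ^ m) (F k)) (\<lambda>k. G k * H k))"

definition rat_vcong :: "nat \<Rightarrow> nat \<Rightarrow> rat \<Rightarrow> int \<Rightarrow> bool" where
  "rat_vcong v k q a \<longleftrightarrow> (\<exists>c d. coprime d (int v) \<and> of_int d * (q - of_int a) = of_int (int v ^ k * c))"

definition rat_eq_z :: "nat \<Rightarrow> rat poly \<Rightarrow> (nat \<Rightarrow> int poly) \<Rightarrow> bool" where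
  "rat_eq_z v g G \<longleftrightarrow> (\<forall>k i. rat_vcong v k (coeff g i) (coeff (G k) i))"

text \<open>Vectors in Z^N / R^N are functions nat => _ that vanish from index N on; a family of
N vectors is a function nat => vector indexed by 0..N-1.\<close>

definition int_span :: "nat \<Rightarrow> (nat \<Rightarrow> nat \<Rightarrow> int) \<Rightarrow> (nat \<Rightarrow> int) set" where
  "int_span N b = {x. \<exists>c. x = (\<lambda>i. \<Sum>j<N. c j * b j i)}"

definition lattice_basis :: "nat \<Rightarrow> (nat \<Rightarrow> nat \<Rightarrow> int) \<Rightarrow> (nat \<Rightarrow> int) set \<Rightarrow> bool" where
  "lattice_basis N b L \<longleftrightarrow> (\<forall>j<N. \<forall>i\<ge>N. b j i = 0) \<and> int_span N b = L \<and>
     (\<forall>c. (\<forall>i. (\<Sum>j<N. c j * b j i) = 0) \<longrightarrow> (\<forall>j<N. c j = 0))"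

definition ip :: "nat \<Rightarrow> (nat \<Rightarrow> real) \<Rightarrow> (nat \<Rightarrow> real) \<Rightarrow> real" where
  "ip N x y = (\<Sum>i<N. x i * y i)"

definition vnorm :: "nat \<Rightarrow> (nat \<Rightarrow> real) \<Rightarrow> real" where
  "vnorm N x = sqrt (ip N x x)"

fun gso_list :: "nat \<Rightarrow> (nat \<Rightarrow> nat \<Rightarrow> real) \<Rightarrow> nat \<Rightarrow> (nat \<Rightarrow> real) list" where
  "gso_list N b 0 = []"
| "gso_list N b (Suc j) = (let G = gso_list N b j in
     G @ [(\<lambda>i. b j i - (\<Sum>k<j. (ip N (b j) (G ! k) / ip N (G ! k) (G ! k)) * (G ! k) i))])"

definition gso :: "nat \<Rightarrow> (nat \<Rightarrow> nat \<Rightarrow> real) \<Rightarrow> nat \<Rightarrow> (nat \<Rightarrow> real)" where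
  "gso N b j = gso_list N b (Suc j) ! j"

definition gs_mu :: "nat \<Rightarrow> (nat \<Rightarrow> nat \<Rightarrow> real) \<Rightarrow> nat \<Rightarrow> nat \<Rightarrow> real" where
  "gs_mu N b j k = ip N (b j) (gso N b k) / ip N (gso N b k) (gso N b k)"

definition LLL_reduced :: "nat \<Rightarrow> (nat \<Rightarrow> nat \<Rightarrow> real) \<Rightarrow> bool" where
  "LLL_reduced N b \<longleftrightarrow> (\<forall>j<N. \<forall>k<j. \<bar>gs_mu N b j k\<bar> \<le> 1/2) \<and>
     (\<forall>j. 0 < j \<and> j < N \<longrightarrow>
        ip N (gso N b j) (gso N b j) \<ge> (3/4 - (gs_mu N b j (j-1))\<^sup>2) * ip N (gso N b (j-1)) (gso N b (j-1)))"

definition poly_norm :: "int poly \<Rightarrow> real" where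
  "poly_norm f = sqrt (\<Sum>i\<le>degree f. (real_of_int (coeff f i))\<^sup>2)"

text \<open>Generators of the all-coefficients lattice (0-based): columns j<r of (I_r; A_1) and
v^l e_j for r \<le> j < r+n.\<close>
definition all_coeff_gen :: "nat \<Rightarrow> nat \<Rightarrow> nat \<Rightarrow> nat \<Rightarrow> (nat \<Rightarrow> nat \<Rightarrow> int) \<Rightarrow> nat \<Rightarrow> nat \<Rightarrow> int" where
  "all_coeff_gen v l r n a j i =
     (if j < r then (if i < r then (if i = j then 1 else 0) else if i < r + n then a (i - r) j else 0)
      else (if i = j then int v ^ l else 0))"

definition proj_first :: "nat \<Rightarrow> (nat \<Rightarrow> int) \<Rightarrow> (nat \<Rightarrow> int)" where
  "proj_first r x = (\<lambda>i. if i < r then x i else 0)"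

end

theory Submission
  imports Defs "Subresultants.Subresultant_Gcd" "HOL-Analysis.L2_Norm"
    "HOL-Computational_Algebra.Fundamental_Theorem_Algebra" "HOL-Computational_Algebra.Field_as_Ring"
begin

text \<open>The vector formed by \<open>w\<^sub>j\<close> and the coefficients of \<open>\<Phi>(g\<^sub>j) = \<Sum> f / (X - \<alpha>)\<close> (over the roots of \<open>g\<^sub>j\<close>) lies
  in the lattice and has norm at most \<open>B'\<close>, so by the usual Gram--Schmidt argument it lies in \<open>L'\<close>; this
  gives one inclusion. Conversely, the LLL conditions bound the norms of \<open>b\<^sub>1, \<dots>, b\<^sub>t\<close> by
  \<open>2\<^sup>n\<^sup>-\<^sup>1 \<surd>2 B'\<close>. Let \<open>(x, y)\<close> be one of them and \<open>H = \<Sum> y\<^sub>i X\<^sup>i\<close>. Modulo \<open>v\<^sup>l\<close> and \<open>f\<^sub>i\<close>, the polynomial \<open>H\<close> is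
  \<open>x\<^sub>i f'\<close>. If \<open>x\<close> took two different values \<open>x\<^sub>i\<close>, \<open>x\<^sub>k\<close> on the factors of some \<open>g\<^sub>j\<close>, then \<open>H - x\<^sub>i f'\<close> would not
  be divisible by \<open>g\<^sub>j\<close>, and adding a small multiple of \<open>\<Phi>(f/g\<^sub>j)\<close>, which is divisible by \<open>g\<^sub>j\<close>, makes it
  coprime to \<open>f\<close>. The resultant of \<open>f\<close> with this polynomial is then a nonzero multiple of \<open>v\<^sup>l\<close>, yet it is
  smaller than \<open>v\<^sup>l\<close>. Hence \<open>x\<close> is constant on the factors of each \<open>g\<^sub>j\<close>, that is, \<open>x \<in> W\<close>.\<close>

section \<open>Gram--Schmidt vectors of reduced bases\<close>

text \<open>The v-adic factors enter only modulo \<open>v^l\<close>, as monic integer polynomials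
  \<open>\<phi> i\<close>, so the argument stays in \<open>int poly\<close>; the ideal generated by
  \<open>v^l\<close> and \<open>\<phi> i\<close> takes the place of a v-adic root. Two facts make
  this ideal sufficient: a constant in it is a multiple of \<open>v^l\<close>, because
  \<open>\<phi> i\<close> is monic and nonconstant; and f' is invertible modulo it, because
  separability modulo v gives a Bezout identity that lifts to \<open>v^l\<close>. The obstacle is
  the nonvanishing of the resultant: H - x_i f' may share factors with f in other blocks, which is
  why it has to be shifted. Multiples k < s suffice, and s <= n keeps the price at (n - 1) B'. As
  for constants, r <= n weakens the LLL factor 2^(r+n-1) for squared lengths to 2^(2n-1). The
  Sylvester matrix has n rows from the shifted polynomial and at most n - 1 rows from f; one row of
  each kind is compared with \<open>v^(l/n)\<close>, whence the exponent in the hypothesis.\<close>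

lemma ip_commute: "ip N x y = ip N y x"
  by (simp add: ip_def mult.commute)

lemma ip_diff_left: "ip N (\<lambda>i. x i - y i) z = ip N x z - ip N y z"
  by (simp add: ip_def left_diff_distrib sum_subtractf)

lemma ip_add_left: "ip N (\<lambda>i. x i + y i) z = ip N x z + ip N y z"
  by (simp add: ip_def distrib_right sum.distrib)

lemma ip_sum_left: "ip N (\<lambda>i. \<Sum>k\<in>K. c k * x k i) z = (\<Sum>k\<in>K. c k * ip N (x k) z)"
  unfolding ip_def sum_distrib_right sum_distrib_left
  by (subst sum.swap) (simp add: mult.assoc)

lemma ip_ge_0: "ip N x x \<ge> 0"
  by (simp add: ip_def sum_nonneg)

text \<open>Handles a vanishing Gram--Schmidt vector: there \<open>gs_mu\<close> is a division by
  zero, hence 0 in HOL, and the inner product that it should cancel is 0 as well.\<close>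

lemma ip_eq_0_left: "ip N x x = 0 \<Longrightarrow> ip N x y = 0"
proof -
  assume "ip N x x = 0"
  hence "\<forall>i\<in>{..<N}. x i * x i = 0"
    unfolding ip_def by (subst (asm) sum_nonneg_eq_0_iff) auto
  thus ?thesis by (simp add: ip_def)
qed

lemma ip_Cauchy_Schwarz: "(ip N x y)\<^sup>2 \<le> ip N x x * ip N y y"
proof -
  have "\<bar>ip N x y\<bar> \<le> (\<Sum>i<N. \<bar>x i\<bar> * \<bar>y i\<bar>)"
    unfolding ip_def abs_mult[symmetric] by (rule sum_abs)
  also have "\<dots> \<le> L2_set x {..<N} * L2_set y {..<N}" by (rule L2_set_mult_ineq)
  finally have "(ip N x y)\<^sup>2 \<le> (L2_set x {..<N} * L2_set y {..<N})\<^sup>2"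
    by (metis abs_ge_zero power2_abs power_mono)
  thus ?thesis
    by (simp add: power_mult_distrib L2_set_def ip_def sum_nonneg power2_eq_square[symmetric])
qed

lemma length_gso_list [simp]: "length (gso_list N b j) = j"
  by (induction j) (auto simp: Let_def)

text \<open>The recursion only appends, so an entry does not depend on how far the list is built.
  This gives access to the textbook recursion \<open>gso_eq\<close>.\<close>

lemma gso_list_nth: "k < j \<Longrightarrow> gso_list N b j ! k = gso N b k"
proof (induction j)
  case (Suc j)
  show ?case
  proof (cases "k = j")
    case False
    hence "k < j" using Suc.prems by simp
    thus ?thesis using Suc.IH by (simp add: Let_def nth_append)
  qed (simp add: gso_def)
qed simp

lemma gso_eq: "gso N b j = (\<lambda>i. b j i - (\<Sum>k<j. gs_mu N b j k * gso N b k i))"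
proof -
  have "gso N b j = (\<lambda>i. b j i - (\<Sum>k<j. (ip N (b j) (gso_list N b j ! k)
      / ip N (gso_list N b j ! k) (gso_list N b j ! k)) * (gso_list N b j ! k) i))"
    by (simp add: gso_def Let_def nth_append)
  also have "\<dots> = (\<lambda>i. b j i - (\<Sum>k<j. gs_mu N b j k * gso N b k i))"
    by (intro ext arg_cong2[where f = "(-)"] refl sum.cong) (auto simp: gso_list_nth gs_mu_def)
  finally show ?thesis .
qed

lemma basis_eq_gso: "b j = (\<lambda>i. gso N b j i + (\<Sum>k<j. gs_mu N b j k * gso N b k i))"
  by (subst gso_eq) simp

text \<open>By strong induction the earlier vectors are pairwise orthogonal, so the projection sum
  collapses to its k-th term, which cancels the inner product of \<open>b j\<close> with
  \<open>gso N b k\<close>.\<close>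

lemma gso_orthogonal: "k < j \<Longrightarrow> ip N (gso N b j) (gso N b k) = 0"
proof (induction j arbitrary: k rule: less_induct)
  case (less j)
  have "ip N (gso N b j) (gso N b k)
      = ip N (b j) (gso N b k) - (\<Sum>k'<j. gs_mu N b j k' * ip N (gso N b k') (gso N b k))"
    by (subst gso_eq) (simp only: ip_diff_left ip_sum_left)
  also have "(\<Sum>k'<j. gs_mu N b j k' * ip N (gso N b k') (gso N b k))
      = (\<Sum>k'<j. if k' = k then gs_mu N b j k * ip N (gso N b k) (gso N b k) else 0)"
  proof (intro sum.cong refl)
    fix k' assume k': "k' \<in> {..<j}"
    show "gs_mu N b j k' * ip N (gso N b k') (gso N b k)
        = (if k' = k then gs_mu N b j k * ip N (gso N b k) (gso N b k) else 0)"
      using less.IH[of k' k] less.IH[of k k'] less.prems k'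
      by (cases k' k rule: linorder_cases) (auto simp: ip_commute[of N "gso N b k'" "gso N b k"])
  qed
  also have "\<dots> = gs_mu N b j k * ip N (gso N b k) (gso N b k)"
    using less.prems by simp
  also have "\<dots> = ip N (b j) (gso N b k)"
    using ip_eq_0_left[of N "gso N b k" "b j"]
    by (cases "ip N (gso N b k) (gso N b k) = 0") (auto simp: gs_mu_def ip_commute)
  finally show ?case by simp
qed

lemma gso_orthogonal': "k \<noteq> j \<Longrightarrow> ip N (gso N b j) (gso N b k) = 0"
  using gso_orthogonal[of k j N b] gso_orthogonal[of j k N b] ip_commute[of N]
  by (cases k j rule: linorder_cases) auto

lemma ip_basis_gso_eq_0: "j < k \<Longrightarrow> ip N (b j) (gso N b k) = 0"
  by (subst basis_eq_gso[of b j N]) (simp add: ip_add_left ip_sum_left gso_orthogonal')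

lemma ip_basis_gso_self: "ip N (b k) (gso N b k) = ip N (gso N b k) (gso N b k)"
  by (subst basis_eq_gso[of b k N]) (simp add: ip_add_left ip_sum_left gso_orthogonal')

text \<open>Pythagoras for the orthogonal expansion of \<open>b j\<close>.\<close>

lemma ip_basis_basis:
  "ip N (b j) (b j) = ip N (gso N b j) (gso N b j)
     + (\<Sum>k<j. (gs_mu N b j k)\<^sup>2 * ip N (gso N b k) (gso N b k))"
proof -
  have *: "ip N (gso N b k) (b j) = gs_mu N b j k * ip N (gso N b k) (gso N b k)" for k
    using ip_eq_0_left[of N "gso N b k" "b j"]
    by (cases "ip N (gso N b k) (gso N b k) = 0") (auto simp: gs_mu_def ip_commute)
  have "ip N (b j) (b j) = ip N (\<lambda>i. gso N b j i + (\<Sum>k<j. gs_mu N b j k * gso N b k i)) (b j)"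
    by (subst (1) basis_eq_gso[of b j N]) simp
  also have "\<dots> = ip N (gso N b j) (b j) + (\<Sum>k<j. gs_mu N b j k * ip N (gso N b k) (b j))"
    by (simp only: ip_add_left ip_sum_left)
  also have "ip N (gso N b j) (b j) = ip N (gso N b j) (gso N b j)"
    using ip_basis_gso_self[of N b j] by (simp add: ip_commute)
  also have "(\<Sum>k<j. gs_mu N b j k * ip N (gso N b k) (b j))
      = (\<Sum>k<j. (gs_mu N b j k)\<^sup>2 * ip N (gso N b k) (gso N b k))"
    by (simp only: * power2_eq_square mult.assoc)
  finally show ?thesis .
qed

section \<open>Short lattice vectors and the length of LLL-reduced bases\<close>

text \<open>Let J be the largest index with a nonzero coefficient. The component of the vector along
  the J-th Gram--Schmidt vector is that vector times the nonzero integer \<open>c J\<close>, so by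
  Cauchy--Schwarz the whole vector is at least as long.\<close>

lemma short_vector_coeffs_eq_0:
  fixes b :: "nat \<Rightarrow> nat \<Rightarrow> int"
  assumes large: "\<And>j. t \<le> j \<Longrightarrow> j < N \<Longrightarrow> vnorm N (gso N (\<lambda>j i. real_of_int (b j i)) j) > C"
    and C: "C \<ge> 0"
    and short: "vnorm N (\<lambda>i. real_of_int (\<Sum>j<N. c j * b j i)) \<le> C"
    and j: "t \<le> j" "j < N"
  shows "c j = 0"
proof (rule ccontr)
  let ?b = "\<lambda>j i. real_of_int (b j i)"
  let ?x = "\<lambda>i. \<Sum>j<N. real_of_int (c j) * ?b j i"
  assume "c j \<noteq> 0"
  define J where "J = Max {k. k < N \<and> c k \<noteq> 0}"
  have jin: "j \<in> {k. k < N \<and> c k \<noteq> 0}" using j \<open>c j \<noteq> 0\<close> by auto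
  have fin: "finite {k. k < N \<and> c k \<noteq> 0}" by auto
  have "J \<in> {k. k < N \<and> c k \<noteq> 0}"
    unfolding J_def using jin fin by (intro Max_in) auto
  moreover have Jmax: "k \<le> J" if "k < N" "c k \<noteq> 0" for k
    unfolding J_def using fin that by (intro Max_ge) auto
  ultimately have J: "J < N" "c J \<noteq> 0" "j \<le> J" using jin by auto
  let ?g = "gso N ?b J"
  have "ip N ?x ?g = (\<Sum>k<N. real_of_int (c k) * ip N (?b k) ?g)"
    by (rule ip_sum_left)
  also have "\<dots> = (\<Sum>k<N. if k = J then real_of_int (c J) * ip N ?g ?g else 0)"
  proof (intro sum.cong refl)
    fix k assume "k \<in> {..<N}"
    thus "real_of_int (c k) * ip N (?b k) ?g
        = (if k = J then real_of_int (c J) * ip N ?g ?g else 0)"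
      using Jmax[of k] ip_basis_gso_eq_0[of k J N ?b] ip_basis_gso_self[of N ?b J]
      by (cases "c k = 0"; cases "k = J") (auto simp: J)
  qed
  also have "\<dots> = real_of_int (c J) * ip N ?g ?g" using J by simp
  finally have eq: "ip N ?x ?g = real_of_int (c J) * ip N ?g ?g" .
  have g: "ip N ?g ?g > C\<^sup>2"
    using large[of J] J j C unfolding vnorm_def by (metis le_trans not_le real_le_lsqrt)
  hence gpos: "ip N ?g ?g > 0" using zero_le_power2[of C] by linarith
  have x: "ip N ?x ?x \<le> C\<^sup>2"
    using short C unfolding vnorm_def by (simp add: sqrt_le_D)
  have "1 \<le> (real_of_int (c J))\<^sup>2" using J(2)
    by (metis of_int_1_le_iff of_int_power zero_less_power2 int_one_le_iff_zero_less)
  hence "(ip N ?g ?g)\<^sup>2 \<le> (real_of_int (c J) * ip N ?g ?g)\<^sup>2"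
    by (simp add: power_mult_distrib mult_le_cancel_right1)
  also have "\<dots> \<le> ip N ?x ?x * ip N ?g ?g"
    unfolding eq[symmetric] by (rule ip_Cauchy_Schwarz)
  finally have "ip N ?g ?g \<le> ip N ?x ?x" using gpos by (simp add: power2_eq_square)
  thus False using g x by linarith
qed

text \<open>Since |mu| <= 1/2, the factor 3/4 - mu^2 is at least 1/2, so each step down in the index
  at most doubles the squared length.\<close>

lemma LLL_reduced_gso_bound:
  assumes red: "LLL_reduced N b" and "t < N" "k \<le> t"
  shows "ip N (gso N b k) (gso N b k) \<le> 2 ^ (t - k) * ip N (gso N b t) (gso N b t)"
  using assms(2,3)
proof (induction t)
  case (Suc t)
  show ?case
  proof (cases "k = Suc t")
    case False
    hence k: "k \<le> t" using Suc.prems by simp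
    let ?G = "\<lambda>j. ip N (gso N b j) (gso N b j)"
    have "\<bar>gs_mu N b (Suc t) t\<bar> \<le> 1/2"
      using red Suc.prems unfolding LLL_reduced_def by auto
    hence "(gs_mu N b (Suc t) t)\<^sup>2 \<le> (1/2)\<^sup>2" by (intro abs_le_square_iff[THEN iffD1]) simp
    hence "1/2 \<le> 3/4 - (gs_mu N b (Suc t) t)\<^sup>2" by (simp add: power2_eq_square)
    hence "1/2 * ?G t \<le> (3/4 - (gs_mu N b (Suc t) t)\<^sup>2) * ?G t"
      by (intro mult_right_mono ip_ge_0)
    also have "\<dots> \<le> ?G (Suc t)"
      using red Suc.prems unfolding LLL_reduced_def by (metis diff_Suc_1 zero_less_Suc)
    finally have "?G t \<le> 2 * ?G (Suc t)" by simp
    have "?G k \<le> 2 ^ (t - k) * ?G t" using Suc k by simp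
    also have "\<dots> \<le> 2 ^ (t - k) * (2 * ?G (Suc t))"
      using \<open>?G t \<le> 2 * ?G (Suc t)\<close> by (intro mult_left_mono) auto
    also have "\<dots> = 2 ^ (Suc t - k) * ?G (Suc t)" using k by (simp add: Suc_diff_le)
    finally show ?thesis .
  qed simp
qed simp

lemma LLL_reduced_basis_bound:
  assumes red: "LLL_reduced N b" and t: "t < N" "j \<le> t"
  shows "ip N (b j) (b j) \<le> 2 ^ t * ip N (gso N b t) (gso N b t)"
proof -
  let ?G = "\<lambda>j. ip N (gso N b j) (gso N b j)"
  have sum_pow: "(2::real) ^ (t - j) + (\<Sum>k<j. 1/4 * 2 ^ (t - k)) \<le> 2 ^ t" if "j \<le> t" for j
  proof -
    \<comment> \<open>The right side is the exact value of the geometric sum, which lets the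
      induction close; it is at most \<open>2 ^ t\<close>, with equality at j = 0.\<close>
    have "(2::real) ^ (t - j) + (\<Sum>k<j. 1/4 * 2 ^ (t - k)) \<le> 2 ^ t * (1/2 + 1/2 ^ (j+1))"
      using that
    proof (induction j)
      case (Suc j)
      have "t - j = Suc (t - Suc j)" using Suc.prems by simp
      hence e: "(2::real) ^ (t - j) = 2 * 2 ^ (t - Suc j)" by simp
      have f: "(2::real) ^ (t - Suc j) = 2 ^ t * (1 / 2 ^ Suc j)"
        using Suc.prems by (simp add: power_diff)
      have "(2::real) ^ (t - Suc j) + (\<Sum>k<Suc j. 1/4 * 2 ^ (t - k))
          = (2 ^ (t - j) + (\<Sum>k<j. 1/4 * 2 ^ (t - k))) - 2 ^ (t - Suc j) / 2"
        using e by simp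
      also have "\<dots> \<le> 2 ^ t * (1/2 + 1/2 ^ (j+1)) - 2 ^ t * (1 / 2 ^ Suc j) / 2"
        using Suc unfolding f by simp
      also have "\<dots> = 2 ^ t * (1/2 + 1/2 ^ (Suc j+1))" by (simp add: field_simps)
      finally show ?case .
    qed simp
    also have "\<dots> \<le> 2 ^ t * 1"
      by (intro mult_left_mono) (auto simp: field_simps)
    finally show ?thesis by simp
  qed
  have "ip N (b j) (b j) = ?G j + (\<Sum>k<j. (gs_mu N b j k)\<^sup>2 * ?G k)" by (rule ip_basis_basis)
  also have "\<dots> \<le> 2 ^ (t - j) * ?G t + (\<Sum>k<j. 1/4 * (2 ^ (t - k) * ?G t))"
  proof (intro add_mono sum_mono mult_mono)
    fix k assume "k \<in> {..<j}"
    hence "\<bar>gs_mu N b j k\<bar> \<le> 1/2" using red t unfolding LLL_reduced_def by auto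
    hence "(gs_mu N b j k)\<^sup>2 \<le> (1/2)\<^sup>2" by (intro abs_le_square_iff[THEN iffD1]) simp
    thus "(gs_mu N b j k)\<^sup>2 \<le> 1/4" by (simp add: power2_eq_square)
  qed (use t LLL_reduced_gso_bound[OF red t(1)] ip_ge_0 in auto)
  also have "\<dots> = (2 ^ (t - j) + (\<Sum>k<j. 1/4 * 2 ^ (t - k))) * ?G t"
    by (simp add: distrib_right sum_distrib_right mult.assoc)
  also have "\<dots> \<le> 2 ^ t * ?G t"
    using sum_pow t by (intro mult_right_mono ip_ge_0) auto
  finally show ?thesis .
qed

section \<open>Resultants\<close>

text \<open>Expanding the product of row sums yields one term for every map from rows to columns;
  the Leibniz formula involves only the permutations among them. \<open>restrict\<close> makes
  permutations extensional, so that they become members of \<open>PiE\<close>.\<close>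

lemma abs_det_le_prod_row_sums:
  fixes A :: "'a :: linordered_idom mat"
  assumes A: "A \<in> carrier_mat n n"
  shows "\<bar>det A\<bar> \<le> (\<Prod>i<n. \<Sum>j<n. \<bar>A $$ (i, j)\<bar>)"
proof -
  let ?P = "{p. p permutes {0..<n}}"
  let ?h = "\<lambda>p. restrict p {..<n}"
  have inj: "inj_on ?h ?P"
  proof (rule inj_onI)
    fix p q assume p: "p \<in> ?P" and q: "q \<in> ?P" and eq: "?h p = ?h q"
    show "p = q"
    proof
      fix x
      show "p x = q x"
        using p q fun_cong[OF eq, of x] by (cases "x < n") (auto simp: permutes_def)
    qed
  qed
  have img: "?h ` ?P \<subseteq> PiE {..<n} (\<lambda>_. {..<n})"
    by (auto simp: PiE_iff dest: permutes_in_image)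
  have "\<bar>det A\<bar> \<le> (\<Sum>p\<in>?P. \<bar>signof p * (\<Prod>i=0..<n. A $$ (i, p i))\<bar>)"
    unfolding det_def'[OF A] by (rule sum_abs)
  also have "\<dots> = (\<Sum>p\<in>?P. \<Prod>i<n. \<bar>A $$ (i, ?h p i)\<bar>)"
    by (intro sum.cong refl) (auto simp: abs_mult abs_prod sign_def lessThan_atLeast0)
  also have "\<dots> = (\<Sum>g\<in>?h ` ?P. \<Prod>i<n. \<bar>A $$ (i, g i)\<bar>)"
    by (simp add: sum.reindex[OF inj])
  also have "\<dots> \<le> (\<Sum>g\<in>PiE {..<n} (\<lambda>_. {..<n}). \<Prod>i<n. \<bar>A $$ (i, g i)\<bar>)"
    by (intro sum_mono2 finite_PiE img prod_nonneg) auto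
  also have "\<dots> = (\<Prod>i<n. \<Sum>j<n. \<bar>A $$ (i, j)\<bar>)"
    by (rule prod_sum_PiE[symmetric]) auto
  finally show ?thesis .
qed

definition poly_norm1 :: "int poly \<Rightarrow> int" where
  "poly_norm1 p = (\<Sum>i\<le>degree p. \<bar>coeff p i\<bar>)"

lemma sum_abs_coeff_le_poly_norm1:
  assumes "finite I" "inj_on h I"
  shows "(\<Sum>j\<in>I. \<bar>coeff p (h j)\<bar>) \<le> poly_norm1 p"
proof -
  have "(\<Sum>j\<in>I. \<bar>coeff p (h j)\<bar>) = (\<Sum>i\<in>h ` I. \<bar>coeff p i\<bar>)"
    using assms(2) by (simp add: sum.reindex)
  also have "\<dots> = (\<Sum>i\<in>h ` I \<inter> {..degree p}. \<bar>coeff p i\<bar>)"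
    using assms(1) by (intro sum.mono_neutral_right) (auto intro!: coeff_eq_0)
  also have "\<dots> \<le> poly_norm1 p"
    unfolding poly_norm1_def by (intro sum_mono2) auto
  finally show ?thesis .
qed

lemma poly_norm1_nonneg: "poly_norm1 p \<ge> 0"
  by (simp add: poly_norm1_def sum_nonneg)

text \<open>Every row of the Sylvester matrix is a shifted copy of the coefficients of p (the first
  \<open>degree q\<close> rows) or of q (the others), so its absolute sum is at most a
  1-norm.\<close>

lemma abs_resultant_le: "\<bar>resultant p q\<bar> \<le> poly_norm1 p ^ degree q * poly_norm1 q ^ degree p"
proof -
  define m n where "m = degree p" and "n = degree q"
  let ?S = "sylvester_mat p q"
  have S: "?S \<in> carrier_mat (m + n) (m + n)"
    using sylvester_carrier_mat[of p q] by (simp add: m_def n_def)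
  have "\<bar>resultant p q\<bar> \<le> (\<Prod>i<m+n. \<Sum>j<m+n. \<bar>?S $$ (i, j)\<bar>)"
    unfolding resultant_def by (rule abs_det_le_prod_row_sums[OF S])
  also have "\<dots> \<le> (\<Prod>i<m+n. if i < n then poly_norm1 p else poly_norm1 q)"
  proof (intro prod_mono conjI sum_nonneg)
    fix i assume i: "i \<in> {..<m+n}"
    show "(\<Sum>j<m+n. \<bar>?S $$ (i, j)\<bar>) \<le> (if i < n then poly_norm1 p else poly_norm1 q)"
    proof (cases "i < n")
      case True
      let ?I = "{j. j < m+n \<and> i \<le> j \<and> j - i \<le> m}"
      have "(\<Sum>j<m+n. \<bar>?S $$ (i, j)\<bar>) = (\<Sum>j<m+n. if j \<in> ?I then \<bar>coeff p (m + i - j)\<bar> else 0)"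
        using i True by (intro sum.cong refl)
          (auto simp: sylvester_index_mat m_def[symmetric] n_def[symmetric])
      also have "\<dots> = (\<Sum>j\<in>{..<m+n} \<inter> ?I. \<bar>coeff p (m + i - j)\<bar>)"
        by (subst sum.inter_restrict) auto
      also have "{..<m+n} \<inter> ?I = ?I" by auto
      also have "(\<Sum>j\<in>?I. \<bar>coeff p (m + i - j)\<bar>) \<le> poly_norm1 p"
        by (intro sum_abs_coeff_le_poly_norm1) (auto simp: inj_on_def)
      finally show ?thesis using True by simp
    next
      case False
      let ?I = "{j. j < m+n \<and> i - n \<le> j \<and> j \<le> i}"
      have "(\<Sum>j<m+n. \<bar>?S $$ (i, j)\<bar>) = (\<Sum>j<m+n. if j \<in> ?I then \<bar>coeff q (i - j)\<bar> else 0)"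
        using i False by (intro sum.cong refl)
          (auto simp: sylvester_index_mat m_def[symmetric] n_def[symmetric])
      also have "\<dots> = (\<Sum>j\<in>{..<m+n} \<inter> ?I. \<bar>coeff q (i - j)\<bar>)"
        by (subst sum.inter_restrict) auto
      also have "{..<m+n} \<inter> ?I = ?I" by auto
      also have "(\<Sum>j\<in>?I. \<bar>coeff q (i - j)\<bar>) \<le> poly_norm1 q"
        by (intro sum_abs_coeff_le_poly_norm1) (auto simp: inj_on_def)
      finally show ?thesis using False by simp
    qed
  qed auto
  also have "\<dots> = poly_norm1 p ^ n * poly_norm1 q ^ m"
  proof -
    have "(\<Prod>i<m+n. if i < n then poly_norm1 p else poly_norm1 q)
        = (\<Prod>i<n. if i < n then poly_norm1 p else poly_norm1 q)
          * (\<Prod>i\<in>{n..<m+n}. if i < n then poly_norm1 p else poly_norm1 q)"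
      by (subst prod.union_disjoint[symmetric]) (auto intro!: prod.cong)
    thus ?thesis by simp
  qed
  finally show ?thesis by (simp add: m_def n_def)
qed

lemma poly_eq_sum_monom_rev:
  assumes "degree p < N"
  shows "(\<Sum>j<N. monom (coeff p (N - Suc j)) (N - Suc j)) = (p :: 'a :: comm_ring_1 poly)"
proof -
  have "(\<Sum>j<N. monom (coeff p (N - Suc j)) (N - Suc j)) = (\<Sum>j<N. monom (coeff p j) j)"
    by (rule sum.nat_diff_reindex)
  also have "\<dots> = (\<Sum>j\<le>degree p. monom (coeff p j) j)"
    using assms by (intro sum.mono_neutral_right) (auto simp: coeff_eq_0)
  also have "\<dots> = p" by (rule poly_as_sum_of_monoms)
  finally show ?thesis .
qed

text \<open>The last row of \<open>adj S * S = det S\<close> for the Sylvester matrix \<open>S\<close>, read in powers of the variable.\<close>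
lemma resultant_in_ideal:
  fixes p q :: "'a :: comm_ring_1 poly"
  assumes "degree p > 0 \<or> degree q > 0"
  obtains u w where "[:resultant p q:] = u * p + w * q"
proof -
  define m n where "m = degree p" and "n = degree q"
  define N where "N = m + n"
  let ?S = "sylvester_mat p q"
  have N: "N > 0" using assms by (auto simp: N_def m_def n_def)
  have S: "?S \<in> carrier_mat N N"
    using sylvester_carrier_mat[of p q] by (simp add: N_def m_def n_def)
  \<comment> \<open>Column j is read as the power \<open>N - Suc j\<close>; the rows then become p
    and q times powers of the variable, and the last column is the constant term.\<close>
  define row where "row i = (\<Sum>j<N. monom (?S $$ (i, j)) (N - Suc j))" for i
  have row_p: "row i = monom 1 (n - Suc i) * p" if "i < n" for i
  proof -
    have "row i = (\<Sum>j<N. monom (coeff (monom 1 (n - Suc i) * p) (N - Suc j)) (N - Suc j))"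
      unfolding row_def
    proof (intro sum.cong refl)
      fix j assume j: "j \<in> {..<N}"
      have "?S $$ (i, j) = coeff (monom 1 (n - Suc i) * p) (N - Suc j)"
        using j that
        by (subst sylvester_index_mat)
           (auto simp: N_def m_def[symmetric] n_def[symmetric] coeff_monom_mult
             intro!: arg_cong[of _ _ "coeff p"] coeff_eq_0)
      thus "monom (?S $$ (i, j)) (N - Suc j) =
          monom (coeff (monom 1 (n - Suc i) * p) (N - Suc j)) (N - Suc j)" by simp
    qed
    also have "\<dots> = monom 1 (n - Suc i) * p"
    proof (rule poly_eq_sum_monom_rev)
      have "degree (monom 1 (n - Suc i) * p) \<le> (n - Suc i) + m"
        using degree_mult_le[of "monom 1 (n - Suc i)" p] degree_monom_le[of "1::'a" "n - Suc i"]
        by (simp add: m_def)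
      thus "degree (monom 1 (n - Suc i) * p) < N" using that by (simp add: N_def)
    qed
    finally show ?thesis .
  qed
  have row_q: "row i = monom 1 (N - Suc i) * q" if "n \<le> i" "i < N" for i
  proof -
    have "row i = (\<Sum>j<N. monom (coeff (monom 1 (N - Suc i) * q) (N - Suc j)) (N - Suc j))"
      unfolding row_def
    proof (intro sum.cong refl)
      fix j assume j: "j \<in> {..<N}"
      have "?S $$ (i, j) = coeff (monom 1 (N - Suc i) * q) (N - Suc j)"
        using j that
        by (subst sylvester_index_mat)
           (auto simp: N_def m_def[symmetric] n_def[symmetric] coeff_monom_mult
             intro!: arg_cong[of _ _ "coeff q"] coeff_eq_0)
      thus "monom (?S $$ (i, j)) (N - Suc j) =
          monom (coeff (monom 1 (N - Suc i) * q) (N - Suc j)) (N - Suc j)" by simp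
    qed
    also have "\<dots> = monom 1 (N - Suc i) * q"
    proof (rule poly_eq_sum_monom_rev)
      have "degree (monom 1 (N - Suc i) * q) \<le> (N - Suc i) + n"
        using degree_mult_le[of "monom 1 (N - Suc i)" q] degree_monom_le[of "1::'a" "N - Suc i"]
        by (simp add: n_def)
      thus "degree (monom 1 (N - Suc i) * q) < N" using that by (simp add: N_def)
    qed
    finally show ?thesis .
  qed
  define c where "c i = adj_mat ?S $$ (N - 1, i)" for i
  have col: "(\<Sum>i<N. c i * ?S $$ (i, j)) = (if j = N - 1 then resultant p q else 0)" if "j < N" for j
  proof -
    have "(adj_mat ?S * ?S) $$ (N - 1, j) = (\<Sum>i<N. c i * ?S $$ (i, j))"
      using S adj_mat(1)[OF S] N that
      by (auto simp: times_mat_def scalar_prod_def c_def lessThan_atLeast0 intro!: sum.cong)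
    thus ?thesis using adj_mat(3)[OF S] N that
      by (cases "j = N - 1") (auto simp: resultant_def)
  qed
  have "(\<Sum>i<N. smult (c i) (row i)) = (\<Sum>j<N. monom (\<Sum>i<N. c i * ?S $$ (i, j)) (N - Suc j))"
    unfolding row_def smult_sum2
    by (subst sum.swap) (simp add: smult_monom monom_sum)
  also have "\<dots> = (\<Sum>j<N. if j = N - 1 then [:resultant p q:] else 0)"
    by (intro sum.cong refl) (use col in \<open>auto simp: monom_0\<close>)
  also have "\<dots> = [:resultant p q:]" using N by simp
  also have "(\<Sum>i<N. smult (c i) (row i))
      = (\<Sum>i<n. smult (c i) (row i)) + (\<Sum>i\<in>{n..<N}. smult (c i) (row i))"
    by (subst sum.union_disjoint[symmetric]) (auto simp: N_def intro!: sum.cong)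
  also have "(\<Sum>i<n. smult (c i) (row i)) = (\<Sum>i<n. smult (c i) (monom 1 (n - Suc i))) * p"
    unfolding sum_distrib_right by (intro sum.cong refl) (simp add: row_p)
  also have "(\<Sum>i\<in>{n..<N}. smult (c i) (row i))
      = (\<Sum>i\<in>{n..<N}. smult (c i) (monom 1 (N - Suc i))) * q"
    unfolding sum_distrib_right by (intro sum.cong refl) (simp add: row_q)
  finally show ?thesis by (rule that[OF sym])
qed

section \<open>Coefficient norms\<close>

lemma poly_norm_eq_L2_set:
  assumes "degree p < N"
  shows "poly_norm p = L2_set (\<lambda>i. real_of_int (coeff p i)) {..<N}"
proof -
  have "(\<Sum>i\<le>degree p. (real_of_int (coeff p i))\<^sup>2) = (\<Sum>i<N. (real_of_int (coeff p i))\<^sup>2)"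
    using assms by (intro sum.mono_neutral_left) (auto simp: coeff_eq_0)
  thus ?thesis by (simp add: poly_norm_def L2_set_def)
qed

lemma poly_norm_nonneg: "poly_norm p \<ge> 0"
  by (simp add: poly_norm_def sum_nonneg)

lemma sum_le_sqrt_card_L2_set:
  assumes "finite A" "\<And>i. i \<in> A \<Longrightarrow> x i \<ge> 0"
  shows "(\<Sum>i\<in>A. x i) \<le> sqrt (real (card A)) * L2_set x A"
  using L2_set_mult_ineq[of "\<lambda>_. 1" x A] assms by (simp add: L2_set_constant)

lemma poly_norm1_le: "real_of_int (poly_norm1 p) \<le> sqrt (real (degree p) + 1) * poly_norm p"
proof -
  have "real_of_int (poly_norm1 p) = (\<Sum>i<Suc (degree p). \<bar>real_of_int (coeff p i)\<bar>)"
    by (simp add: poly_norm1_def lessThan_Suc_atMost)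
  also have "\<dots> \<le> sqrt (real (card {..<Suc (degree p)}))
      * L2_set (\<lambda>i. \<bar>real_of_int (coeff p i)\<bar>) {..<Suc (degree p)}"
    by (rule sum_le_sqrt_card_L2_set) auto
  also have "\<dots> = sqrt (real (degree p) + 1) * poly_norm p"
    by (subst poly_norm_eq_L2_set[of p "Suc (degree p)"]) (simp_all add: add.commute L2_set_def)
  finally show ?thesis .
qed

lemma poly_norm_ge_1:
  assumes "p \<noteq> 0"
  shows "poly_norm p \<ge> 1"
proof -
  have "lead_coeff p \<noteq> 0" using assms by simp
  hence "\<bar>lead_coeff p\<bar> \<ge> 1" by linarith
  hence "1 \<le> \<bar>real_of_int (lead_coeff p)\<bar>" by linarith
  also have "\<dots> \<le> L2_set (\<lambda>i. \<bar>real_of_int (coeff p i)\<bar>) {..<Suc (degree p)}"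
    by (rule member_le_L2_set) auto
  also have "\<dots> = poly_norm p"
    by (subst poly_norm_eq_L2_set[of p "Suc (degree p)"]) (simp_all add: L2_set_def)
  finally show ?thesis .
qed

lemma poly_norm_add: "poly_norm (p + q) \<le> poly_norm p + poly_norm q"
proof -
  define N where "N = Suc (max (degree p) (degree q))"
  have "degree p < N" "degree q < N" "degree (p + q) < N"
    using degree_add_le_max[of p q] by (auto simp: N_def)
  thus ?thesis
    using L2_set_triangle_ineq[of "\<lambda>i. real_of_int (coeff p i)" "\<lambda>i. real_of_int (coeff q i)" "{..<N}"]
    by (simp add: poly_norm_eq_L2_set)
qed

lemma poly_norm_smult: "poly_norm (smult c p) = \<bar>real_of_int c\<bar> * poly_norm p"
proof -
  have "degree (smult c p) < Suc (degree p)" "degree p < Suc (degree p)" 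
    by (auto simp: degree_smult_le le_imp_less_Suc)
  thus ?thesis
    by (simp only: poly_norm_eq_L2_set)
       (simp add: L2_set_def power_mult_distrib sum_distrib_left[symmetric] real_sqrt_mult)
qed

lemma poly_norm_pderiv_le: "poly_norm (pderiv p) \<le> real (degree p) * poly_norm p"
proof (cases "degree p = 0")
  case True
  hence "pderiv p = 0" by (simp add: pderiv_eq_0_iff)
  thus ?thesis using True by (simp add: poly_norm_def)
next
  case False
  define n where "n = degree p"
  have "(poly_norm (pderiv p))\<^sup>2 = (\<Sum>i<n. (real (Suc i) * real_of_int (coeff p (Suc i)))\<^sup>2)"
    using False
    by (subst poly_norm_eq_L2_set[of _ n])
       (auto simp: n_def degree_pderiv L2_set_def coeff_pderiv sum_nonneg)
  also have "\<dots> \<le> (\<Sum>i<n. (real n)\<^sup>2 * (real_of_int (coeff p (Suc i)))\<^sup>2)"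
    unfolding power_mult_distrib by (intro sum_mono mult_right_mono power_mono) auto
  also have "\<dots> \<le> (\<Sum>i<Suc n. (real n)\<^sup>2 * (real_of_int (coeff p i))\<^sup>2)"
    by (subst sum.lessThan_Suc_shift) simp
  also have "\<dots> = (real n * poly_norm p)\<^sup>2"
    by (subst poly_norm_eq_L2_set[of p "Suc n"])
       (auto simp: n_def L2_set_def power_mult_distrib sum_nonneg simp flip: sum_distrib_left
         simp del: sum.lessThan_Suc)
  finally show ?thesis
    unfolding n_def by (rule power2_le_imp_le) (simp add: poly_norm_nonneg)
qed

section \<open>Norms of logarithmic derivatives\<close>

text \<open>Bounds n (n + 1) / 2, the total weight of the partial sums below, by the square of
  \<open>2 ^ (n - 1)\<close>.\<close>

lemma Suc_mult_le_power: "n * (n + 1) \<le> 2 * 4 ^ (n - 1)" if "n \<ge> 1"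
  using that
proof (induction n rule: dec_induct)
  case (step k)
  have "(4::nat) ^ k = 4 * 4 ^ (k - 1)" using step.hyps by (simp add: power_eq_if)
  moreover have "Suc k * (Suc k + 1) \<le> 4 * (k * (k + 1))" proof -
    have "1 * 2 \<le> k * (4 * k - 1 + 1)" using step.hyps by (intro mult_mono) auto
    thus ?thesis using step.hyps by (simp add: algebra_simps)
  qed
  ultimately show ?case using step.IH by simp
qed simp

text \<open>Synthetic division by a linear factor, from the top if the root is in the unit disc and from
  the bottom otherwise, never amplifies the partial sums of the coefficients.\<close>
lemma L2_set_linear_quotient_le:
  fixes f h :: "complex poly"
  assumes f: "f = [:-\<alpha>, 1:] * h" and n: "degree f \<le> n" "n \<ge> 1"
  shows "L2_set (\<lambda>i. cmod (coeff h i)) {..<n} \<le> 2 ^ (n - 1) * L2_set (\<lambda>i. cmod (coeff f i)) {..n}"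
proof -
  define A where "A = L2_set (\<lambda>i. cmod (coeff f i)) {..n}"
  have f_0: "coeff f 0 = - \<alpha> * coeff h 0" and f_Suc: "coeff f (Suc i) = coeff h i - \<alpha> * coeff h (Suc i)" for i
    by (simp_all add: f)
  have h_0: "coeff h k = 0" if "k \<ge> n" for k
  proof (cases "h = 0")
    case False
    hence "degree f = Suc (degree h)" by (simp add: f degree_mult_eq del: mult_pCons_left)
    thus ?thesis using that n by (intro coeff_eq_0) auto
  qed simp
  have part: "(\<Sum>i\<in>I. cmod (coeff f i)) \<le> sqrt (real (card I)) * A" if "I \<subseteq> {..n}" for I
  proof -
    have "finite I" using that finite_subset by blast
    hence "(\<Sum>i\<in>I. cmod (coeff f i)) \<le> sqrt (real (card I)) * L2_set (\<lambda>i. cmod (coeff f i)) I"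
      by (intro sum_le_sqrt_card_L2_set) auto
    also have "\<dots> \<le> sqrt (real (card I)) * A"
      unfolding A_def L2_set_def using that by (intro mult_left_mono real_sqrt_le_mono sum_mono2) auto
    finally show ?thesis .
  qed
  \<comment> \<open>\<open>\<pi> k\<close> counts the coefficients of f in the partial sum that
    bounds \<open>coeff h k\<close>: n - k of them from the top, k + 1 from the bottom.
    Cauchy--Schwarz brings in the root of this count, and both families of counts have the same
    total.\<close>
  have "\<exists>\<pi>. (\<forall>k<n. (cmod (coeff h k))\<^sup>2 \<le> real (\<pi> k) * A\<^sup>2) \<and> (\<Sum>k<n. \<pi> k) = n * (n + 1) div 2"
  proof (cases "cmod \<alpha> \<le> 1")
    case True
    have bd: "cmod (coeff h (n - j)) \<le> (\<Sum>i\<in>{n-j<..n}. cmod (coeff f i))" if "j \<le> n" for j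
      using that
    proof (induction j)
      case (Suc j)
      have nj: "n - j = Suc (n - Suc j)" using Suc.prems by simp
      have "coeff h (n - Suc j) = coeff f (n - j) + \<alpha> * coeff h (n - j)"
        unfolding nj using f_Suc[of "n - Suc j"] by simp
      hence "cmod (coeff h (n - Suc j)) \<le> cmod (coeff f (n - j)) + cmod \<alpha> * cmod (coeff h (n - j))"
        by (metis norm_mult norm_triangle_ineq)
      also have "\<dots> \<le> cmod (coeff f (n - j)) + 1 * (\<Sum>i\<in>{n-j<..n}. cmod (coeff f i))"
        using Suc True by (intro add_mono mult_mono) auto
      also have "\<dots> = (\<Sum>i\<in>insert (n - j) {n-j<..n}. cmod (coeff f i))" by simp
      also have "insert (n - j) {n-j<..n} = {n - Suc j<..n}" using Suc.prems by auto
      finally show ?case .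
    qed (simp add: h_0)
    have "(cmod (coeff h k))\<^sup>2 \<le> real (n - k) * A\<^sup>2" if "k < n" for k
    proof -
      have "cmod (coeff h k) \<le> sqrt (real (n - k)) * A"
        using bd[of "n - k"] part[of "{k<..n}"] that by (simp add: subset_eq)
      hence "(cmod (coeff h k))\<^sup>2 \<le> (sqrt (real (n - k)) * A)\<^sup>2" by (intro power_mono) auto
      thus ?thesis by (simp add: power_mult_distrib)
    qed
    moreover have "(\<Sum>k<n. n - k) = n * (n + 1) div 2"
    proof -
      have "(\<Sum>k<n. n - k) = (\<Sum>k<n. Suc k)"
        by (subst sum.nat_diff_reindex[symmetric]) (auto intro!: sum.cong)
      also have "\<dots> = n * (n + 1) div 2"
        by (induction n) auto
      finally show ?thesis .
    qed
    ultimately show ?thesis by blast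
  next
    case False
    have step: "cmod z \<le> cmod (\<alpha> * z)" for z
      using False mult_right_mono[of 1 "cmod \<alpha>" "cmod z"] by (simp add: norm_mult)
    have bd: "cmod (coeff h k) \<le> (\<Sum>i\<le>k. cmod (coeff f i))" for k
    proof (induction k)
      case 0
      thus ?case using step[of "coeff h 0"] by (simp add: f_0)
    next
      case (Suc k)
      have "cmod (coeff h (Suc k)) \<le> cmod (\<alpha> * coeff h (Suc k))" by (rule step)
      also have "\<alpha> * coeff h (Suc k) = coeff h k - coeff f (Suc k)" by (simp add: f_Suc)
      also have "cmod \<dots> \<le> cmod (coeff h k) + cmod (coeff f (Suc k))" by (rule norm_triangle_ineq4)
      finally show ?case using Suc by simp
    qed
    have "(cmod (coeff h k))\<^sup>2 \<le> real (Suc k) * A\<^sup>2" if "k < n" for k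
    proof -
      have "cmod (coeff h k) \<le> sqrt (real (Suc k)) * A"
        using bd[of k] part[of "{..k}"] that by simp
      hence "(cmod (coeff h k))\<^sup>2 \<le> (sqrt (real (Suc k)) * A)\<^sup>2" by (intro power_mono) auto
      thus ?thesis by (simp add: power_mult_distrib)
    qed
    moreover have "(\<Sum>k<n. Suc k) = n * (n + 1) div 2"
      by (induction n) auto
    ultimately show ?thesis by blast
  qed
  then obtain \<pi> where \<pi>: "\<And>k. k < n \<Longrightarrow> (cmod (coeff h k))\<^sup>2 \<le> real (\<pi> k) * A\<^sup>2"
    and sum_\<pi>: "(\<Sum>k<n. \<pi> k) = n * (n + 1) div 2" by blast
  have "(\<Sum>k<n. (cmod (coeff h k))\<^sup>2) \<le> (\<Sum>k<n. real (\<pi> k) * A\<^sup>2)"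
    using \<pi> by (intro sum_mono) auto
  also have "\<dots> = real (n * (n + 1) div 2) * A\<^sup>2"
    by (simp only: sum_\<pi>[symmetric] of_nat_sum sum_distrib_right)
  also have "\<dots> \<le> real (4 ^ (n - 1)) * A\<^sup>2"
    using Suc_mult_le_power[OF n(2)] by (intro mult_right_mono of_nat_mono) auto
  also have "\<dots> = (2 ^ (n - 1) * A)\<^sup>2"
    by (simp add: power_mult_distrib flip: power_mult power_mult[of 2 2])
      (simp add: power_mult mult.commute)
  finally show ?thesis
    unfolding A_def[symmetric] by (auto simp: L2_set_def A_def intro!: real_le_lsqrt sum_nonneg mult_nonneg_nonneg)
qed

text \<open>The polynomial \<open>G' Q = f G'/G\<close> is the sum of the \<open>f / (X - \<alpha>)\<close> over the roots \<open>\<alpha>\<close> of \<open>G\<close>.\<close>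
lemma L2_set_log_deriv_complex_le:
  fixes f G Q :: "complex poly"
  assumes "f = G * Q" "degree f \<le> n" "n \<ge> 1" "G \<noteq> 0"
  shows "L2_set (\<lambda>i. cmod (coeff (pderiv G * Q) i)) {..<n}
    \<le> real (degree G) * (2 ^ (n - 1) * L2_set (\<lambda>i. cmod (coeff f i)) {..n})"
  using assms
proof (induction "degree G" arbitrary: G Q)
  case 0
  hence "pderiv G = 0" by (simp add: pderiv_eq_0_iff)
  thus ?case using 0 by (simp add: L2_set_def)
next
  case (Suc d)
  let ?C = "2 ^ (n - 1) * L2_set (\<lambda>i. cmod (coeff f i)) {..n}"
  have "\<not> constant (poly G)" using Suc.hyps(2) by (simp add: constant_degree)
  then obtain \<alpha> where "poly G \<alpha> = 0" using fundamental_theorem_of_algebra by blast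
  then obtain G1 where G1: "G = [:-\<alpha>, 1:] * G1" by (auto simp: poly_eq_0_iff_dvd dvd_def)
  have "G1 \<noteq> 0" using Suc.prems G1 by auto
  hence deg: "degree G = Suc (degree G1)" by (simp add: G1 degree_mult_eq del: mult_pCons_left)
  have deriv: "pderiv G = G1 + [:-\<alpha>, 1:] * pderiv G1"
    unfolding G1 pderiv_mult by (simp add: pderiv_pCons del: mult_pCons_left)
  \<comment> \<open>One root \<alpha> is peeled off: \<open>G1 * Q\<close> is f / (X - \<alpha>),
    and the rest is the same expression for \<open>G1\<close>, with the linear factor moved into the
    cofactor.\<close>
  have split: "pderiv G * Q = G1 * Q + pderiv G1 * ([:-\<alpha>, 1:] * Q)"
    unfolding deriv by (simp only: distrib_right distrib_left mult_ac)
  have f1: "f = [:-\<alpha>, 1:] * (G1 * Q)" and f2: "f = G1 * ([:-\<alpha>, 1:] * Q)"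
    using Suc.prems(1) unfolding G1 by (simp_all only: mult_ac)
  have "L2_set (\<lambda>i. cmod (coeff (pderiv G * Q) i)) {..<n}
      \<le> L2_set (\<lambda>i. cmod (coeff (G1 * Q) i) + cmod (coeff (pderiv G1 * ([:-\<alpha>, 1:] * Q)) i)) {..<n}"
    unfolding split coeff_add by (intro L2_set_mono norm_triangle_ineq) auto
  also have "\<dots> \<le> L2_set (\<lambda>i. cmod (coeff (G1 * Q) i)) {..<n}
      + L2_set (\<lambda>i. cmod (coeff (pderiv G1 * ([:-\<alpha>, 1:] * Q)) i)) {..<n}"
    by (rule L2_set_triangle_ineq)
  also have "\<dots> \<le> ?C + real (degree G1) * ?C"
    using Suc.prems(2,3) Suc.hyps(2) deg \<open>G1 \<noteq> 0\<close> f1 f2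
    by (intro add_mono L2_set_linear_quotient_le[of f \<alpha>] Suc.hyps(1)) auto
  also have "\<dots> = real (degree G) * ?C" by (simp add: deg distrib_right)
  finally show ?case .
qed

text \<open>The origin of B: G has at most n complex roots, and each contributes at most 2^(n-1)
  times the norm of f.\<close>

lemma L2_set_log_deriv_le:
  fixes f G Q :: "int poly"
  assumes f: "f = G * Q" "degree f = n" "n \<ge> 1"
  shows "L2_set (\<lambda>i. real_of_int (coeff (pderiv G * Q) i)) {..<n} \<le> 2 ^ (n - 1) * real n * poly_norm f"
proof -
  let ?c = "of_int_poly :: int poly \<Rightarrow> complex poly"
  have "f \<noteq> 0" using f by auto
  hence "G \<noteq> 0" "Q \<noteq> 0" using f by auto
  hence deg: "degree G \<le> n" using f by (auto simp: degree_mult_eq)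
  have "L2_set (\<lambda>i. cmod (coeff (pderiv (?c G) * ?c Q) i)) {..<n}
      \<le> real (degree (?c G)) * (2 ^ (n - 1) * L2_set (\<lambda>i. cmod (coeff (?c f) i)) {..n})"
    using f \<open>G \<noteq> 0\<close> by (intro L2_set_log_deriv_complex_le) (simp_all add: hom_distribs flip: of_int_poly_hom.hom_mult)
  also have "pderiv (?c G) * ?c Q = ?c (pderiv G * Q)" by (simp add: hom_distribs)
  finally have "L2_set (\<lambda>i. real_of_int (coeff (pderiv G * Q) i)) {..<n}
      \<le> real (degree G) * (2 ^ (n - 1) * L2_set (\<lambda>i. real_of_int (coeff f i)) {..n})"
    by (simp add: L2_set_def)
  also have "L2_set (\<lambda>i. real_of_int (coeff f i)) {..n} = poly_norm f"
    using f poly_norm_eq_L2_set[of f "Suc n"] by (simp add: lessThan_Suc_atMost)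
  also have "real (degree G) * (2 ^ (n - 1) * poly_norm f) \<le> real n * (2 ^ (n - 1) * poly_norm f)"
    using deg by (intro mult_right_mono) (auto simp: poly_norm_nonneg)
  finally show ?thesis by (simp add: mult_ac)
qed

lemma degree_log_deriv:
  fixes f p q :: "int poly"
  assumes "f = p * q" "degree f \<ge> 1"
  shows "degree (pderiv p * q) < degree f"
proof (cases "degree p = 0")
  case True
  hence "pderiv p = 0" by (simp add: pderiv_eq_0_iff)
  thus ?thesis using assms(2) by simp
next
  case False
  have "p \<noteq> 0" "q \<noteq> 0" using assms by auto
  hence "degree f = degree p + degree q" using assms(1) by (simp add: degree_mult_eq)
  moreover have "degree (pderiv p * q) \<le> (degree p - 1) + degree q"
    using degree_mult_le[of "pderiv p" q] by (simp add: degree_pderiv)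
  ultimately show ?thesis using False by simp
qed

lemma poly_norm_log_deriv_le:
  fixes f p q :: "int poly"
  assumes "f = p * q" "degree f \<ge> 1"
  shows "poly_norm (pderiv p * q) \<le> 2 ^ (degree f - 1) * real (degree f) * poly_norm f"
  using L2_set_log_deriv_le[OF assms(1) refl assms(2)]
  by (simp add: poly_norm_eq_L2_set[OF degree_log_deriv[OF assms]])

lemma two_times_le_power: "2 * n \<le> 2 ^ (n - 1)" if "n \<ge> 4"
  using that
proof (induction n rule: dec_induct)
  case (step k)
  have "(2::nat) ^ k = 2 * 2 ^ (k - 1)" using step.hyps by (simp add: power_eq_if)
  thus ?case using step by simp
qed simp

section \<open>The numerical estimate behind the hypothesis on v^l\<close>

text \<open>With F the norm of f, the left side is the resultant bound that arises in
  \<open>block_constant\<close>. The factor from f is at least 1, so its exponent may be raised from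
  n - 1 to n, and it suffices to compare bases. The roots are replaced by rational bounds: sqrt 2 by
  3/2, sqrt (1 + (nF)^2) by nF + 1/4, and sqrt (n (n + 1)) by n + 1/2.\<close>

lemma resultant_size_bound:
  fixes F B' :: real
  assumes n: "n \<ge> 2" and F: "F \<ge> 1" and B': "B' \<ge> 2 ^ (n - 1) * real n * F"
  shows "(sqrt (real n + 1) * F) ^ (n - 1)
      * (sqrt (real n) * (sqrt 2 * 2 ^ (n - 1) * B' * sqrt (1 + (real n * F)\<^sup>2) + (real n - 1) * B')) ^ n
    \<le> (F * (2 ^ (n - 1) + real n) * B' * (1 + B')) ^ n"
proof -
  define q where "q = (2::real) ^ (n - 1)"
  define Y where "Y = q * real n * F"
  have q: "q \<ge> 1" by (simp add: q_def)
  have YqF: "Y \<ge> q * real n" using F q mult_left_mono[of 1 F "q * real n"] by (simp add: Y_def)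
  have B'0: "B' \<ge> Y" using B' by (simp add: Y_def q_def)
  have Y0: "Y \<ge> 0" using YqF q by (meson mult_nonneg_nonneg of_nat_0_le_iff order.trans zero_le_one)
  \<comment> \<open>The general argument needs 2n <= q, which holds only from n = 4 on; for n = 2
    and n = 3 the inequality is linear in Y and follows from Y >= q n.\<close>
  have main: "(real n + 1/2) * (3/2 * Y + 3/8 * q + real n - 1) \<le> (q + real n) * (1 + Y)"
  proof -
    consider "n = 2" | "n = 3" | "n \<ge> 4" using n by linarith
    thus ?thesis
    proof cases
      case 1
      thus ?thesis using YqF by (simp add: q_def algebra_simps)
    next
      case 2
      thus ?thesis using YqF by (simp add: q_def algebra_simps)
    next
      case 3
      have "real (2 * n) \<le> real (2 ^ (n - 1))" using two_times_le_power[OF 3] by (simp only: of_nat_le_iff)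
      hence qn: "q \<ge> 2 * real n" by (simp add: q_def)
      have "(real n + 1/2) * (3/8 * q + real n - 1) \<le> (5/4 * real n) * q"
        using 3 qn q by (intro mult_mono) auto
      also have "\<dots> = 5/4 * (q * real n)" by simp
      also have "\<dots> \<le> 5/4 * Y" using YqF by simp
      also have "\<dots> \<le> (3/2 * real n - 3/4) * Y" using 3 Y0 by (intro mult_right_mono) auto
      also have "\<dots> \<le> (q - real n / 2 - 3/4) * Y" using qn Y0 by (intro mult_right_mono) auto
      finally have *: "(real n + 1/2) * (3/8 * q + real n - 1) \<le> (q - real n / 2 - 3/4) * Y" .
      have "(real n + 1/2) * (3/2 * Y + 3/8 * q + real n - 1)
          = (real n + 1/2) * (3/8 * q + real n - 1) + (3/2 * real n + 3/4) * Y"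
        by (simp add: algebra_simps)
      also have "\<dots> \<le> (q - real n / 2 - 3/4) * Y + (3/2 * real n + 3/4) * Y" using * by simp
      also have "\<dots> = (q + real n) * Y" by (simp add: algebra_simps)
      also have "\<dots> \<le> (q + real n) * (1 + Y)" using q by (intro mult_left_mono) auto
      finally show ?thesis .
    qed
  qed
  have s2: "sqrt 2 \<le> 3/2" by (rule real_le_lsqrt) (auto simp: power2_eq_square)
  have sF: "sqrt (1 + (real n * F)\<^sup>2) \<le> real n * F + 1/4"
  proof (rule real_le_lsqrt)
    have "2 * 1 \<le> real n * F" using n F by (intro mult_mono) auto
    thus "1 + (real n * F)\<^sup>2 \<le> (real n * F + 1/4)\<^sup>2" by (simp add: power2_eq_square algebra_simps)
    show "0 \<le> real n * F + 1/4" using F by simp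
  qed
  have sn: "sqrt (real n + 1) * sqrt (real n) \<le> real n + 1/2"
    unfolding real_sqrt_mult[symmetric]
    by (rule real_le_lsqrt) (auto simp: power2_eq_square algebra_simps)
  define X where "X = sqrt 2 * q * B' * sqrt (1 + (real n * F)\<^sup>2) + (real n - 1) * B'"
  have "X = (sqrt 2 * q * sqrt (1 + (real n * F)\<^sup>2) + (real n - 1)) * B'"
    by (simp add: X_def algebra_simps)
  also have "\<dots> \<le> (3/2 * q * (real n * F + 1/4) + (real n - 1)) * B'"
    using B'0 Y0 s2 sF q F by (intro mult_right_mono add_mono mult_mono order.refl) auto
  also have "\<dots> = (3/2 * Y + 3/8 * q + real n - 1) * B'" by (simp add: Y_def algebra_simps)
  finally have X: "X \<le> (3/2 * Y + 3/8 * q + real n - 1) * B'" .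
  have X0: "X \<ge> 0" unfolding X_def using n B'0 Y0 q by simp
  have base: "sqrt (real n + 1) * F * (sqrt (real n) * X) \<le> F * (q + real n) * B' * (1 + B')"
  proof -
    have "sqrt (real n + 1) * F * (sqrt (real n) * X) = (sqrt (real n + 1) * sqrt (real n)) * F * X" by simp
    also have "\<dots> \<le> (real n + 1/2) * F * ((3/2 * Y + 3/8 * q + real n - 1) * B')"
      using sn X X0 F by (intro mult_mono) auto
    also have "\<dots> = F * B' * ((real n + 1/2) * (3/2 * Y + 3/8 * q + real n - 1))" by (simp add: mult_ac)
    also have "\<dots> \<le> F * B' * ((q + real n) * (1 + Y))"
      using main F B'0 Y0 by (intro mult_left_mono) auto
    also have "\<dots> \<le> F * B' * ((q + real n) * (1 + B'))"
      using B'0 F Y0 q by (intro mult_left_mono) auto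
    finally show ?thesis by (simp add: mult_ac)
  qed
  have "1 * 1 \<le> sqrt (real n + 1) * F" using F by (intro mult_mono) auto
  hence "(sqrt (real n + 1) * F) ^ (n - 1) \<le> (sqrt (real n + 1) * F) ^ n"
    by (intro power_increasing) auto
  hence "(sqrt (real n + 1) * F) ^ (n - 1) * (sqrt (real n) * X) ^ n
      \<le> (sqrt (real n + 1) * F) ^ n * (sqrt (real n) * X) ^ n"
    using X0 by (intro mult_right_mono) auto
  also have "\<dots> = (sqrt (real n + 1) * F * (sqrt (real n) * X)) ^ n" by (simp add: power_mult_distrib)
  also have "\<dots> \<le> (F * (q + real n) * B' * (1 + B')) ^ n"
    using base F X0 by (intro power_mono) auto
  finally show ?thesis by (simp add: X_def q_def)
qed

section \<open>Blocks of modular factors\<close>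

text \<open>The highest coefficient of q not divisible by m, at index I, would survive modulo m in
  \<open>p * q\<close> at index \<open>degree p + I\<close>, as p is monic. Looking only at indices
  from \<open>degree p\<close> on makes the lemma applicable when the product is known only up to
  terms of lower degree, as in \<open>I_const\<close>.\<close>

lemma monic_cancel_mod:
  fixes p q :: "int poly"
  assumes p: "monic p" and dvd: "\<And>i. i \<ge> degree p \<Longrightarrow> m dvd coeff (p * q) i"
  shows "[:m:] dvd q"
proof (rule ccontr)
  assume "\<not> [:m:] dvd q"
  then obtain i0 where i0: "\<not> m dvd coeff q i0" by (auto simp: const_poly_dvd_iff)
  define A where "A = {i. \<not> m dvd coeff q i}"
  have "A \<subseteq> {..degree q}" by (auto simp: A_def intro!: le_degree)
  hence fin: "finite A" using finite_subset by blast
  define I where "I = Max A"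
  have I: "\<not> m dvd coeff q I" using Max_in[of A] fin i0 by (auto simp: I_def A_def)
  have above: "m dvd coeff q i" if "i > I" for i
    using Max_ge[OF fin, of i] that by (auto simp: I_def A_def)
  define d where "d = degree p"
  have "coeff (p * q) (d + I) = (\<Sum>a\<le>d + I. coeff p a * coeff q (d + I - a))" by (rule coeff_mult)
  also have "\<dots> = coeff p d * coeff q (d + I - d)
      + (\<Sum>a\<in>{..d + I} - {d}. coeff p a * coeff q (d + I - a))"
    by (rule sum.remove) auto
  finally have "coeff q I = coeff (p * q) (d + I)
      - (\<Sum>a\<in>{..d + I} - {d}. coeff p a * coeff q (d + I - a))"
    using p by (simp add: d_def)
  moreover have "m dvd (\<Sum>a\<in>{..d + I} - {d}. coeff p a * coeff q (d + I - a))"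
  proof (rule dvd_sum)
    fix a assume "a \<in> {..d + I} - {d}"
    then consider "a < d" | "a > d" "a \<le> d + I" by fastforce
    thus "m dvd coeff p a * coeff q (d + I - a)"
    proof cases
      case 1
      thus ?thesis by (intro dvd_mult above) auto
    next
      case 2
      thus ?thesis by (simp add: d_def coeff_eq_0)
    qed
  qed
  ultimately have "m dvd coeff q I" using dvd[of "d + I"] by (simp add: d_def dvd_diff)
  thus False using I by simp
qed

lemma const_poly_dvd_smult_cancel:
  fixes p :: "int poly"
  assumes "coprime c m" "[:m:] dvd smult c p"
  shows "[:m:] dvd p"
proof -
  have "coprime m c" using assms(1) by (simp add: coprime_commute)
  thus ?thesis using assms(2) by (simp add: const_poly_dvd_iff coprime_dvd_mult_right_iff)
qed

lemma const_poly_dvd_pderiv: "[:m:] dvd p \<Longrightarrow> [:m:] dvd pderiv p" for p :: "int poly"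
  by (auto simp: const_poly_dvd_iff coeff_pderiv)

lemma rat_poly_clear_denominators:
  obtains d :: int and q :: "int poly" where "d > 0" "of_int_poly q = smult (of_int d) (p :: rat poly)"
proof -
  have "\<exists>d q. d > 0 \<and> of_int_poly q = smult (of_int d :: rat) p"
  proof (induction p)
    case 0
    show ?case by (intro exI[of _ 1] exI[of _ 0]) auto
  next
    case (pCons a p)
    then obtain d q where d: "d > 0" "of_int_poly q = smult (of_int d) p" by blast
    obtain x y where xy: "quotient_of a = (x, y)" by force
    hence y: "y > 0" and a: "a = of_int x / of_int y"
      by (auto intro: quotient_of_denom_pos quotient_of_div)
    have "of_int_poly (pCons (d * x) (smult y q)) = smult (of_int (d * y)) (pCons a p)"
      using y d by (simp add: a hom_distribs mult.commute)
    thus ?case using d(1) y by (intro exI[of _ "d * y"] exI) auto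
  qed
  thus ?thesis using that by blast
qed

text \<open>Gauss: once denominators are cleared by d, the content of the cofactor is a multiple of
  d because p is primitive, so d cancels. This is why the rational factors are represented by
  primitive polynomials.\<close>

lemma rat_dvd_imp_int_dvd:
  fixes p q :: "int poly"
  assumes "content p = 1" "(of_int_poly p :: rat poly) dvd of_int_poly q"
  shows "p dvd q"
proof -
  obtain h where h: "of_int_poly q = of_int_poly p * (h :: rat poly)" using assms(2) by (elim dvdE)
  obtain d h' where d: "d > 0" and hh: "of_int_poly h' = smult (of_int d) h"
    by (rule rat_poly_clear_denominators)
  have "of_int_poly (smult d q) = (of_int_poly (p * h') :: rat poly)"
    by (simp add: hom_distribs h hh)
  hence eq: "smult d q = p * h'" by (simp only: of_int_poly_hom.eq_iff)
  hence "content h' = normalize d * content q"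
    using assms(1) by (metis content_mult content_smult mult_1)
  hence "[:d:] dvd h'" by (simp add: const_poly_dvd_iff_dvd_content)
  then obtain h'' where "h' = [:d:] * h''" by (elim dvdE)
  hence "smult d q = smult d (p * h'')" using eq by simp
  hence "smult d (q - p * h'') = 0" by (simp add: smult_diff_right)
  hence "q = p * h''" using d by simp
  thus ?thesis by simp
qed

lemma degree_gcd_eq_0_of_coprime:
  assumes "coprime (of_int_poly p :: rat poly) (of_int_poly q)"
  shows "degree (gcd p q) = 0"
proof -
  have "is_unit (of_int_poly (gcd p q) :: rat poly)"
    using coprime_common_divisor[OF assms, of "of_int_poly (gcd p q)"] by (simp add: of_int_poly_hom.hom_dvd)
  hence "degree (of_int_poly (gcd p q) :: rat poly) = 0" by (simp add: is_unit_iff_degree)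
  thus ?thesis by simp
qed

text \<open>Here \<open>m\<close> stands for \<open>v\<^sup>l\<close>, the \<open>\<phi>\<^sub>i\<close> are monic integer polynomials congruent modulo \<open>m\<close> to the \<open>v\<close>-adic
  factors, \<open>G\<^sub>j\<close> is the primitive integer multiple of the rational factor \<open>g\<^sub>j\<close>, and \<open>S\<^sub>j\<close> (the block of
  \<open>G\<^sub>j\<close>) is the support of \<open>w\<^sub>j\<close>.\<close>
locale factor_data =
  fixes m :: int and f :: "int poly" and r s :: nat and \<phi> G Q :: "nat \<Rightarrow> int poly"
    and S :: "nat \<Rightarrow> nat set" and c :: rat
  assumes phi_monic: "i < r \<Longrightarrow> monic (\<phi> i)" and phi_deg: "i < r \<Longrightarrow> degree (\<phi> i) \<ge> 1"
    and f_cong: "[:m:] dvd f - smult (lead_coeff f) (\<Prod>i<r. \<phi> i)"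
    and f_lead: "coprime (lead_coeff f) m" and m_not_unit: "\<not> m dvd 1"
    and f_bezout: "\<exists>p q. [:m:] dvd f * p + pderiv f * q - 1"
    and f_eq: "j < s \<Longrightarrow> f = G j * Q j"
    and S_subset: "j < s \<Longrightarrow> S j \<subseteq> {..<r}"
    and G_cong: "j < s \<Longrightarrow> [:m:] dvd G j - smult (lead_coeff (G j)) (\<Prod>i\<in>S j. \<phi> i)"
    and G_content: "j < s \<Longrightarrow> content (G j) = 1"
    and G_irred: "j < s \<Longrightarrow> irreducible (of_int_poly (G j) :: rat poly)"
    and f_prod: "(of_int_poly f :: rat poly) = smult c (\<Prod>j<s. of_int_poly (G j))"
    and f_sep: "coprime (of_int_poly f :: rat poly) (pderiv (of_int_poly f))"
begin

lemma G_lead: "j < s \<Longrightarrow> coprime (lead_coeff (G j)) m"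
  using f_lead f_eq[of j] by (metis coprime_mult_left_iff lead_coeff_mult)

text \<open>This is f \<phi>_i' / \<phi>_i with f replaced by its factorization modulo m, which
  makes the division exact in \<open>int poly\<close>.\<close>

definition \<Phi> :: "nat \<Rightarrow> int poly" where
  "\<Phi> i = smult (lead_coeff f) ((\<Prod>k\<in>{..<r} - {i}. \<phi> k) * pderiv (\<phi> i))"

lemma Phi_cong:
  assumes "i < r"
  shows "[:m:] dvd f * pderiv (\<phi> i) - \<phi> i * \<Phi> i"
proof -
  have "\<phi> i * \<Phi> i = smult (lead_coeff f) (\<Prod>i<r. \<phi> i) * pderiv (\<phi> i)"
    using assms by (simp add: \<Phi>_def prod.remove[of "{..<r}" i \<phi>] mult_ac)
  hence "f * pderiv (\<phi> i) - \<phi> i * \<Phi> i = (f - smult (lead_coeff f) (\<Prod>i<r. \<phi> i)) * pderiv (\<phi> i)"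
    by (simp only: left_diff_distrib)
  thus ?thesis using f_cong by (metis dvd_mult2)
qed

text \<open>Additivity of the logarithmic derivative, multiplied out so that no division modulo m
  occurs.\<close>

lemma prod_Phi_cong:
  assumes "A \<subseteq> {..<r}"
  shows "[:m:] dvd f * pderiv (\<Prod>i\<in>A. \<phi> i) - (\<Prod>i\<in>A. \<phi> i) * (\<Sum>i\<in>A. \<Phi> i)"
proof -
  have fin: "finite A" using assms finite_subset by blast
  have "f * pderiv (\<Prod>i\<in>A. \<phi> i) - (\<Prod>i\<in>A. \<phi> i) * (\<Sum>i\<in>A. \<Phi> i)
      = (\<Sum>i\<in>A. f * (prod \<phi> (A - {i}) * pderiv (\<phi> i)) - prod \<phi> A * \<Phi> i)"
    by (simp add: pderiv_prod sum_distrib_left sum_subtractf)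
  also have "\<dots> = (\<Sum>i\<in>A. prod \<phi> (A - {i}) * (f * pderiv (\<phi> i) - \<phi> i * \<Phi> i))"
    using fin by (intro sum.cong refl) (simp add: prod.remove[of A _ \<phi>] algebra_simps)
  also have "[:m:] dvd \<dots>"
    using assms by (intro dvd_sum dvd_mult Phi_cong) auto
  finally show ?thesis .
qed

lemma pderiv_f_cong: "[:m:] dvd pderiv f - (\<Sum>i<r. \<Phi> i)"
proof -
  have "pderiv (smult (lead_coeff f) (\<Prod>i<r. \<phi> i)) = (\<Sum>i<r. \<Phi> i)"
    by (simp add: pderiv_smult pderiv_prod \<Phi>_def smult_sum2)
  thus ?thesis using const_poly_dvd_pderiv[OF f_cong] by (simp add: pderiv_diff)
qed

text \<open>Modulo m, \<open>G j\<close> is a unit times a monic polynomial, hence not a zero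
  divisor.\<close>

lemma G_cancel:
  assumes j: "j < s" and dvd: "[:m:] dvd G j * X"
  shows "[:m:] dvd X"
proof -
  let ?\<Pi> = "\<Prod>i\<in>S j. \<phi> i"
  have "smult (lead_coeff (G j)) (?\<Pi> * X) = G j * X - (G j - smult (lead_coeff (G j)) ?\<Pi>) * X"
    by (simp add: algebra_simps)
  hence "[:m:] dvd smult (lead_coeff (G j)) (?\<Pi> * X)"
    using G_cong[OF j] dvd by (metis dvd_diff dvd_mult2)
  hence "[:m:] dvd ?\<Pi> * X" using G_lead[OF j] const_poly_dvd_smult_cancel by blast
  moreover have "monic ?\<Pi>"
    using S_subset[OF j] phi_monic by (intro monic_prod) auto
  ultimately show ?thesis by (intro monic_cancel_mod[of ?\<Pi>]) (auto simp: const_poly_dvd_iff)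
qed

text \<open>After multiplication by \<open>G j\<close>, which may be cancelled modulo m, this is
  \<open>prod_Phi_cong\<close> for the block up to the error \<open>?E\<close>. It is what places
  the vector of \<open>G j\<close> in the lattice.\<close>

lemma log_deriv_cong:
  assumes j: "j < s"
  shows "[:m:] dvd pderiv (G j) * Q j - (\<Sum>i\<in>S j. \<Phi> i)"
proof (rule G_cancel[OF j])
  let ?\<Pi> = "\<Prod>i\<in>S j. \<phi> i" and ?\<Sigma> = "\<Sum>i\<in>S j. \<Phi> i" and ?c = "lead_coeff (G j)"
  let ?E = "G j - smult ?c ?\<Pi>"
  have E: "[:m:] dvd ?E" "[:m:] dvd pderiv ?E"
    using G_cong[OF j] const_poly_dvd_pderiv by blast+
  have "G j * (pderiv (G j) * Q j - ?\<Sigma>) = f * pderiv (G j) - G j * ?\<Sigma>"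
    by (simp add: f_eq[OF j] algebra_simps)
  also have "\<dots> = smult ?c (f * pderiv ?\<Pi> - ?\<Pi> * ?\<Sigma>) + (f * pderiv ?E - ?E * ?\<Sigma>)"
    by (simp add: pderiv_diff pderiv_smult algebra_simps smult_diff_right)
  also have "[:m:] dvd \<dots>"
    by (rule dvd_add[OF dvd_smult[OF prod_Phi_cong[OF S_subset[OF j]]]
          dvd_diff[OF dvd_mult[OF E(2)] dvd_mult2[OF E(1)]]])
  finally show "[:m:] dvd G j * (pderiv (G j) * Q j - ?\<Sigma>)" .
qed

section \<open>The ideals (m, \<phi>_i)\<close>

text \<open>The ideal generated by the constant m and \<open>\<phi> i\<close>; membership stands for
  divisibility by the i-th v-adic factor modulo \<open>v^l\<close>.\<close>

definition I :: "nat \<Rightarrow> int poly set" where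
  "I i = {p. \<exists>u. [:m:] dvd p - \<phi> i * u}"

lemma I_add: "p \<in> I i \<Longrightarrow> q \<in> I i \<Longrightarrow> p + q \<in> I i"
proof -
  assume "p \<in> I i" "q \<in> I i"
  then obtain u w where "[:m:] dvd p - \<phi> i * u" "[:m:] dvd q - \<phi> i * w" by (auto simp: I_def)
  hence "[:m:] dvd (p - \<phi> i * u) + (q - \<phi> i * w)" by (rule dvd_add)
  also have "(p - \<phi> i * u) + (q - \<phi> i * w) = (p + q) - \<phi> i * (u + w)" by (simp add: algebra_simps)
  finally show ?thesis by (auto simp: I_def)
qed

lemma I_mult: "p \<in> I i \<Longrightarrow> q * p \<in> I i"
proof -
  assume "p \<in> I i"
  then obtain u where "[:m:] dvd p - \<phi> i * u" by (auto simp: I_def)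
  hence "[:m:] dvd q * (p - \<phi> i * u)" by (rule dvd_mult)
  also have "q * (p - \<phi> i * u) = q * p - \<phi> i * (q * u)" by (simp add: algebra_simps)
  finally show ?thesis by (auto simp: I_def)
qed

lemma I_smult: "p \<in> I i \<Longrightarrow> smult a p \<in> I i"
  using I_mult[of p i "[:a:]"] by simp

lemma I_diff: "p \<in> I i \<Longrightarrow> q \<in> I i \<Longrightarrow> p - q \<in> I i"
  using I_add[of p i "smult (-1) q"] I_smult[of q i "-1"] by simp

lemma I_dvd: "p \<in> I i \<Longrightarrow> p dvd q \<Longrightarrow> q \<in> I i"
  by (auto simp: dvd_def mult.commute[of p] intro: I_mult)

lemma I_modulus: "[:m:] dvd p \<Longrightarrow> p \<in> I i"
  unfolding I_def by (auto intro!: exI[of _ 0])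

lemma I_phi: "\<phi> i dvd p \<Longrightarrow> p \<in> I i"
proof -
  assume "\<phi> i dvd p"
  then obtain u where "p - \<phi> i * u = 0" by (auto elim!: dvdE)
  thus ?thesis unfolding I_def by (metis (mono_tags) dvd_0_right mem_Collect_eq)
qed

lemma I_cong: "[:m:] dvd p - q \<Longrightarrow> q \<in> I i \<Longrightarrow> p \<in> I i"
  using I_add[OF I_modulus, of "p - q" q i] by simp

text \<open>From \<open>degree (\<phi> i)\<close> upwards the constant has no coefficients, so there
  the multiple of \<open>\<phi> i\<close> vanishes modulo m by itself. Monic cancellation makes the
  multiplier divisible by m, and then R as well.\<close>

lemma I_const:
  assumes "i < r" "[:R:] \<in> I i"
  shows "m dvd R"
proof -
  obtain u where u: "[:m:] dvd [:R:] - \<phi> i * u" using assms(2) by (auto simp: I_def)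
  have "[:m:] dvd u"
  proof (rule monic_cancel_mod)
    fix k assume k: "k \<ge> degree (\<phi> i)"
    hence "coeff [:R:] k = 0" using phi_deg[OF assms(1)] by (cases k) auto
    moreover have "m dvd coeff ([:R:] - \<phi> i * u) k" using u by (auto simp: const_poly_dvd_iff)
    ultimately show "m dvd coeff (\<phi> i * u) k" by simp
  qed (use phi_monic[OF assms(1)] in auto)
  hence "[:m:] dvd ([:R:] - \<phi> i * u) + \<phi> i * u" using u by (intro dvd_add dvd_mult)
  hence "[:m:] dvd [:R:]" by simp
  hence "m dvd coeff [:R:] 0" unfolding const_poly_dvd_iff by blast
  thus ?thesis by simp
qed

lemma f_in_I: "i < r \<Longrightarrow> f \<in> I i"
  by (rule I_cong[OF f_cong]) (auto intro: I_smult I_phi dvd_prodI)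

lemma Phi_in_I: "i < r \<Longrightarrow> k \<noteq> i \<Longrightarrow> \<Phi> k \<in> I i"
  unfolding \<Phi>_def by (intro I_smult I_phi dvd_mult2 dvd_prodI) auto

lemma G_in_I: "j < s \<Longrightarrow> i \<in> S j \<Longrightarrow> G j \<in> I i"
  using S_subset by (intro I_cong[OF G_cong] I_smult I_phi dvd_prodI) (auto intro: finite_subset)

lemma combination_cong:
  assumes i: "i < r" and H: "[:m:] dvd H - (\<Sum>k<r. smult (x k) (\<Phi> k))"
  shows "H - smult (x i) (\<Phi> i) \<in> I i"
proof -
  have others: "(\<Sum>k\<in>{..<r} - {i}. smult (x k) (\<Phi> k)) \<in> I i"
  proof -
    have "(\<Sum>k\<in>K. smult (x k) (\<Phi> k)) \<in> I i" if "finite K" "i \<notin> K" for K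
      using that
    proof (induction K rule: finite_induct)
      case empty
      show ?case by (simp add: I_phi)
    qed (auto intro!: I_add I_smult Phi_in_I i)
    thus ?thesis by auto
  qed
  have eq: "H - smult (x i) (\<Phi> i) - (\<Sum>k\<in>{..<r} - {i}. smult (x k) (\<Phi> k))
      = H - (\<Sum>k<r. smult (x k) (\<Phi> k))"
  proof -
    have "(\<Sum>k<r. smult (x k) (\<Phi> k))
        = smult (x i) (\<Phi> i) + (\<Sum>k\<in>{..<r} - {i}. smult (x k) (\<Phi> k))"
      using i by (intro sum.remove) auto
    thus ?thesis by (simp only: diff_diff_add)
  qed
  show ?thesis by (rule I_cong[OF H[folded eq] others])
qed

text \<open>Taking all \<open>x k\<close> equal to 1 in \<open>combination_cong\<close> shows that
  \<open>\<Phi> i\<close> and f' agree modulo \<open>I i\<close>, since f' is the sum of all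
  \<open>\<Phi> k\<close> modulo m.\<close>

lemma combination_cong_pderiv:
  assumes i: "i < r" and H: "[:m:] dvd H - (\<Sum>k<r. smult (x k) (\<Phi> k))"
  shows "H - smult (x i) (pderiv f) \<in> I i"
proof -
  have "pderiv f - \<Phi> i \<in> I i"
    using combination_cong[of i "pderiv f" "\<lambda>_. 1"] i pderiv_f_cong by simp
  hence "(H - smult (x i) (\<Phi> i)) - smult (x i) (pderiv f - \<Phi> i) \<in> I i"
    using combination_cong[OF assms] by (meson I_diff I_smult)
  thus ?thesis by (simp add: smult_diff_right)
qed

text \<open>The two congruences for H put (x_i - a) f' into \<open>I i\<close>. There f is 0 and
  Bezout makes f' a unit, so the constant x_i - a itself lies in \<open>I i\<close>.\<close>

lemma G_dvd_imp_modulus_dvd: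
  assumes j: "j < s" and i: "i \<in> S j"
    and H: "[:m:] dvd H - (\<Sum>k<r. smult (x k) (\<Phi> k))"
    and dvd: "G j dvd H - smult a (pderiv f)"
  shows "m dvd x i - a"
proof -
  have ir: "i < r" using S_subset[OF j] i by auto
  have "(H - smult a (pderiv f)) - (H - smult (x i) (pderiv f)) \<in> I i"
    using I_dvd[OF G_in_I[OF j i] dvd] combination_cong_pderiv[OF ir H] by (rule I_diff)
  hence 1: "smult (x i - a) (pderiv f) \<in> I i" by (simp add: smult_diff_left)
  obtain p q where pq: "[:m:] dvd f * p + pderiv f * q - 1" using f_bezout by blast
  have "q * smult (x i - a) (pderiv f) + smult (x i - a) p * f \<in> I i"
    by (intro I_add I_mult 1 f_in_I ir)
  also have "q * smult (x i - a) (pderiv f) + smult (x i - a) p * f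
      = smult (x i - a) (f * p + pderiv f * q)" by (simp add: algebra_simps smult_add_right)
  finally have "smult (x i - a) (f * p + pderiv f * q) \<in> I i" .
  moreover have "smult (x i - a) (f * p + pderiv f * q - 1) \<in> I i"
    by (intro I_smult I_modulus pq)
  ultimately have "smult (x i - a) (f * p + pderiv f * q)
      - smult (x i - a) (f * p + pderiv f * q - 1) \<in> I i" by (rule I_diff)
  moreover have "smult (x i - a) A - smult (x i - a) (A - 1) = [:x i - a:]" for A
    unfolding smult_diff_right by (simp add: algebra_simps)
  ultimately have "[:x i - a:] \<in> I i" by (simp only:)
  thus ?thesis by (rule I_const[OF ir])
qed

lemma G_dvd_cofactor:
  assumes "j < s" "j' < s" "j' \<noteq> j"
  shows "(of_int_poly (G j') :: rat poly) dvd of_int_poly (Q j)"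
proof -
  let ?g = "\<lambda>j. of_int_poly (G j) :: rat poly"
  have "?g j \<noteq> 0" using G_irred[OF assms(1)] by auto
  have "?g j * of_int_poly (Q j) = of_int_poly f"
    using f_eq[OF assms(1)] by (simp add: hom_distribs)
  also have "\<dots> = smult c (?g j * (\<Prod>j\<in>{..<s} - {j}. ?g j))"
    using assms by (simp add: f_prod prod.remove[of "{..<s}" j])
  finally have "?g j * of_int_poly (Q j) = ?g j * smult c (\<Prod>j\<in>{..<s} - {j}. ?g j)" by simp
  hence "of_int_poly (Q j) = smult c (\<Prod>j\<in>{..<s} - {j}. ?g j)"
    using \<open>?g j \<noteq> 0\<close> by (simp only: mult_cancel_left) simp
  also have "?g j' dvd \<dots>" using assms by (intro dvd_smult dvd_prodI) auto
  finally show ?thesis .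
qed

text \<open>The term \<open>k G\<^sub>j Q\<^sub>j'\<close> vanishes on the block of \<open>G\<^sub>j\<close> and equals \<open>k f'\<close> on the other blocks, each of
  which therefore excludes at most one value of \<open>k\<close>.\<close>
lemma ex_coprime_shift:
  assumes j: "j < s" and i: "i \<in> S j" "i' \<in> S j" and ne: "\<not> m dvd x i' - x i"
    and H: "[:m:] dvd H - (\<Sum>k<r. smult (x k) (\<Phi> k))"
  obtains k P where "k < s"
    "P = H - smult (x i) (pderiv f) + smult (int k) (G j * pderiv (Q j))"
    "coprime (of_int_poly f :: rat poly) (of_int_poly P)"
    "\<And>R u w. [:R:] = u * f + w * P \<Longrightarrow> m dvd R"
proof -
  let ?R = "of_int_poly :: int poly \<Rightarrow> rat poly"
  define P where "P k = H - smult (x i) (pderiv f) + smult (int k) (G j * pderiv (Q j))" for k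
  have ir: "i < r" using S_subset[OF j] i by auto
  have not_j: "\<not> ?R (G j) dvd ?R (P k)" for k
  proof
    assume "?R (G j) dvd ?R (P k)"
    hence "G j dvd P k" by (rule rat_dvd_imp_int_dvd[OF G_content[OF j]])
    hence "G j dvd P k - smult (int k) (G j * pderiv (Q j))"
      by (intro dvd_diff dvd_smult) auto
    hence "G j dvd H - smult (x i) (pderiv f)" by (simp add: P_def)
    thus False using G_dvd_imp_modulus_dvd[OF j i(2) H] ne by blast
  qed
  \<comment> \<open>Two values of k for the same block would make \<open>G j'\<close> divide
    \<open>G j * pderiv (Q j)\<close>. It also divides \<open>Q j\<close>, hence f', against the
    separability of f.\<close>
  have unique: "k = k'" if j': "j' < s" "j' \<noteq> j"
    and dvd: "?R (G j') dvd ?R (P k)" "?R (G j') dvd ?R (P k')" for j' k k'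
  proof (rule ccontr)
    assume "k \<noteq> k'"
    have "?R (G j') dvd ?R (P k) - ?R (P k')" using dvd by (rule dvd_diff)
    also have "?R (P k) - ?R (P k') = ?R (P k - P k')" by (simp add: hom_distribs)
    also have "P k - P k' = smult (int k - int k') (G j * pderiv (Q j))"
      by (simp add: P_def smult_diff_left)
    also have "?R \<dots> = smult (of_int (int k - int k')) (?R (G j * pderiv (Q j)))"
      by (simp only: of_int_hom.map_poly_hom_smult)
    finally have "?R (G j') dvd ?R (G j * pderiv (Q j))"
      using \<open>k \<noteq> k'\<close> by (subst (asm) dvd_smult_iff) auto
    moreover have "?R (G j') dvd ?R (pderiv (G j) * Q j)"
      using G_dvd_cofactor[OF j j'] by (simp add: hom_distribs)
    ultimately have "?R (G j') dvd ?R (G j * pderiv (Q j)) + ?R (pderiv (G j) * Q j)" by (rule dvd_add)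
    also have "\<dots> = pderiv (?R f)"
    proof -
      have "pderiv f = G j * pderiv (Q j) + pderiv (G j) * Q j"
        by (subst f_eq[OF j]) (simp add: pderiv_mult mult.commute)
      thus ?thesis by (simp flip: of_int_poly_hom.hom_mult of_int_poly_hom.hom_add of_int_hom.map_poly_pderiv)
    qed
    finally have "?R (G j') dvd pderiv (?R f)" .
    moreover have "?R (G j') dvd ?R f"
      by (subst f_eq[OF j'(1)]) (simp add: hom_distribs)
    ultimately have "is_unit (?R (G j'))" using f_sep coprime_common_divisor by blast
    thus False using G_irred[OF j'(1)] by (simp add: irreducible_def)
  qed
  \<comment> \<open>Pigeonhole: there are s values of k but only s - 1 blocks other than j, and each
    spoils at most one value.\<close>
  obtain k where k: "k < s" "\<And>j'. j' < s \<Longrightarrow> \<not> ?R (G j') dvd ?R (P k)"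
  proof (rule ccontr)
    assume "\<not> thesis"
    hence "\<forall>k<s. \<exists>j'<s. ?R (G j') dvd ?R (P k)" using that by blast
    then obtain h where h: "\<And>k. k < s \<Longrightarrow> h k < s \<and> ?R (G (h k)) dvd ?R (P k)" by metis
    have hj: "h k \<noteq> j" if "k < s" for k using h[OF that] not_j[of k] by metis
    have "inj_on h {..<s}"
    proof (rule inj_onI)
      fix k k' assume kk': "k \<in> {..<s}" "k' \<in> {..<s}" "h k = h k'"
      have "?R (G (h k)) dvd ?R (P k')" using h[of k'] kk' by simp
      thus "k = k'" using unique[of "h k" k k'] h[of k] hj[of k] kk' by simp
    qed
    moreover have "h ` {..<s} \<subseteq> {..<s} - {j}" using h hj by auto
    ultimately have "card {..<s} \<le> card ({..<s} - {j})" by (intro card_inj_on_le) auto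
    thus False using j by simp
  qed
  have cop: "coprime (?R f) (?R (P k))"
  proof -
    have "coprime (?R (G j')) (?R (P k))" if "j' < s" for j'
      using prime_elem_imp_coprime[OF field_poly_irreducible_imp_prime[OF G_irred[OF that]] k(2)[OF that]] .
    hence "coprime (\<Prod>j<s. ?R (G j)) (?R (P k))" by (intro prod_coprime_left) auto
    moreover have "c \<noteq> 0" using f_prod f_sep by (cases "c = 0") auto
    moreover from this have "is_unit [:c:]" by (simp add: is_unit_const_poly_iff)
    ultimately have "coprime ([:c:] * (\<Prod>j<s. ?R (G j))) (?R (P k))"
      by (simp only: coprime_mult_left_iff is_unit_left_imp_coprime)
    thus ?thesis by (simp add: f_prod)
  qed
  \<comment> \<open>Since i belongs to block j, the shift is a multiple of \<open>G j\<close> and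
    lies in \<open>I i\<close>; so does all of \<open>P k\<close>, and with it every integer in the
    ideal of f and \<open>P k\<close>.\<close>
  have modulus: "m dvd R" if R: "[:R:] = u * f + w * P k" for R u w
  proof -
    have "P k \<in> I i"
      unfolding P_def by (intro I_add I_smult combination_cong_pderiv ir H I_dvd[OF G_in_I[OF j i(1)]]) auto
    hence "[:R:] \<in> I i" unfolding R by (intro I_add I_mult f_in_I ir)
    thus ?thesis by (rule I_const[OF ir])
  qed
  show ?thesis by (rule that[OF k(1) P_def cop modulus])
qed

section \<open>Degrees, and the blocks as a partition\<close>

text \<open>If the degrees differed, the leading coefficient of g, a unit modulo m, would stand
  alone in the congruence and be divisible by m.\<close>

lemma degree_eq_of_cong:
  assumes p: "monic p" and dvd: "[:m:] dvd g - smult (lead_coeff g) p" and cop: "coprime (lead_coeff g) m"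
  shows "degree g = degree p"
proof -
  have not_dvd: "\<not> m dvd lead_coeff g"
    using cop m_not_unit by (meson coprime_common_divisor dvd_refl)
  have *: "m dvd coeff g k - lead_coeff g * coeff p k" for k
    using dvd unfolding const_poly_dvd_iff by simp
  show ?thesis
  proof (cases "degree g" "degree p" rule: linorder_cases)
    case less
    thus ?thesis using *[of "degree p"] p not_dvd by (simp add: coeff_eq_0)
  next
    case greater
    thus ?thesis using *[of "degree g"] not_dvd by (simp add: coeff_eq_0)
  qed
qed

lemma degree_prod_phi:
  assumes "A \<subseteq> {..<r}"
  shows "degree (\<Prod>i\<in>A. \<phi> i) = (\<Sum>i\<in>A. degree (\<phi> i))"
  using assms phi_monic by (intro degree_prod_eq_sum_degree) force

lemma monic_prod_phi:
  assumes "A \<subseteq> {..<r}"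
  shows "monic (\<Prod>i\<in>A. \<phi> i)"
  using assms phi_monic by (intro monic_prod) auto

lemma degree_f: "degree f = (\<Sum>i<r. degree (\<phi> i))"
  using degree_eq_of_cong[OF monic_prod_phi f_cong f_lead] degree_prod_phi by simp

lemma degree_G: "j < s \<Longrightarrow> degree (G j) = (\<Sum>i\<in>S j. degree (\<phi> i))"
  using degree_eq_of_cong[OF monic_prod_phi[OF S_subset] G_cong G_lead] degree_prod_phi[OF S_subset]
  by simp

lemma degree_G_pos:
  assumes "j < s"
  shows "degree (G j) \<ge> 1"
proof (rule ccontr)
  assume "\<not> degree (G j) \<ge> 1"
  hence "degree (of_int_poly (G j) :: rat poly) = 0" by simp
  moreover have "(of_int_poly (G j) :: rat poly) \<noteq> 0" using G_irred[OF assms] by auto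
  ultimately have "is_unit (of_int_poly (G j) :: rat poly)" using is_unit_iff_degree by blast
  thus False using G_irred[OF assms] by (simp add: irreducible_def)
qed

lemma sum_degree_G: "degree f = (\<Sum>j<s. degree (G j))"
proof -
  have c0: "c \<noteq> 0" using f_prod f_sep by (cases "c = 0") auto
  have "degree f = degree (of_int_poly f :: rat poly)" by simp
  also have "\<dots> = degree (\<Prod>j<s. of_int_poly (G j) :: rat poly)"
    unfolding f_prod using c0 by simp
  also have "\<dots> = (\<Sum>j<s. degree (of_int_poly (G j) :: rat poly))"
    using G_irred by (intro degree_prod_eq_sum_degree) (metis irreducible_def lessThan_iff)
  finally show ?thesis by simp
qed

lemma r_le_degree: "r \<le> degree f"
  unfolding degree_f using sum_mono[of "{..<r}" "\<lambda>_. 1" "\<lambda>i. degree (\<phi> i)"] phi_deg by simp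

lemma s_le_degree: "s \<le> degree f"
  unfolding sum_degree_G using sum_mono[of "{..<s}" "\<lambda>_. 1" "\<lambda>j. degree (G j)"] degree_G_pos by simp

lemma S_nonempty: "j < s \<Longrightarrow> S j \<noteq> {}"
  using degree_G[of j] degree_G_pos[of j] by auto

text \<open>A common index i would put \<open>G j\<close> and its cofactor \<open>Q j\<close> into
  \<open>I i\<close>, hence f and f' too, and by Bezout also 1.\<close>

lemma blocks_disjoint:
  assumes j: "j < s" "j' < s" "j' \<noteq> j" and i: "i \<in> S j" "i \<in> S j'"
  shows False
proof -
  have ir: "i < r" using S_subset[OF j(1)] i by auto
  have "G j' dvd Q j"
    by (rule rat_dvd_imp_int_dvd[OF G_content[OF j(2)] G_dvd_cofactor[OF j]])
  hence Q: "Q j \<in> I i" using I_dvd[OF G_in_I[OF j(2) i(2)]] by blast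
  have f': "pderiv f = pderiv (Q j) * G j + pderiv (G j) * Q j"
    by (subst f_eq[OF j(1)]) (simp add: pderiv_mult mult.commute add.commute)
  have 1: "pderiv f \<in> I i"
    unfolding f' by (rule I_add[OF I_mult[OF G_in_I[OF j(1) i(1)]] I_mult[OF Q]])
  obtain p q where pq: "[:m:] dvd f * p + pderiv f * q - 1" using f_bezout by blast
  have "f * p + pderiv f * q \<in> I i"
    using I_add[OF I_mult[OF f_in_I[OF ir]] I_mult[OF 1], of p q] by (simp only: mult.commute)
  hence "(f * p + pderiv f * q) - (f * p + pderiv f * q - 1) \<in> I i"
    using I_modulus[OF pq] by (rule I_diff)
  hence "[:1:] \<in> I i" by (simp add: one_pCons[symmetric])
  thus False using I_const[OF ir] m_not_unit by blast
qed

text \<open>Degree count: the degrees of the blocks add up to the degree of f, and so do those of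
  all \<open>\<phi> i\<close>. As no index is counted twice and all degrees are positive, none can
  be missing.\<close>

lemma blocks_cover:
  assumes i: "i < r"
  obtains j where "j < s" "i \<in> S j"
proof -
  define e where "e i = card {j. j < s \<and> i \<in> S j}" for i
  have e_le: "e i \<le> 1" for i
  proof -
    have "\<exists>j0. {j. j < s \<and> i \<in> S j} \<subseteq> {j0}"
      using blocks_disjoint[of _ _ i] by blast
    then obtain j0 where "{j. j < s \<and> i \<in> S j} \<subseteq> {j0}" by blast
    thus ?thesis unfolding e_def using card_mono[of "{j0}"] by force
  qed
  have "(\<Sum>i<r. degree (\<phi> i)) = (\<Sum>j<s. \<Sum>i\<in>S j. degree (\<phi> i))"
    using degree_f sum_degree_G degree_G by simp
  also have "\<dots> = (\<Sum>j<s. \<Sum>i<r. if i \<in> S j then degree (\<phi> i) else 0)"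
  proof (rule sum.cong[OF refl])
    fix j assume "j \<in> {..<s}"
    hence "S j \<inter> {..<r} = S j" using S_subset by auto
    thus "(\<Sum>i\<in>S j. degree (\<phi> i)) = (\<Sum>i<r. if i \<in> S j then degree (\<phi> i) else 0)"
      using sum.inter_restrict[of "{..<r}" "\<lambda>i. degree (\<phi> i)" "S j"] by (simp add: Int_commute)
  qed
  also have "\<dots> = (\<Sum>i<r. \<Sum>j<s. if i \<in> S j then degree (\<phi> i) else 0)"
    by (rule sum.swap)
  also have "\<dots> = (\<Sum>i<r. e i * degree (\<phi> i))"
  proof (rule sum.cong[OF refl])
    fix i
    have "(\<Sum>j<s. if i \<in> S j then degree (\<phi> i) else 0)
        = (\<Sum>j\<in>{j. j < s \<and> i \<in> S j}. degree (\<phi> i))"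
      by (rule sum.mono_neutral_cong_right) auto
    thus "(\<Sum>j<s. if i \<in> S j then degree (\<phi> i) else 0) = e i * degree (\<phi> i)"
      by (simp add: e_def)
  qed
  finally have eq: "(\<Sum>i<r. e i * degree (\<phi> i)) = (\<Sum>i<r. degree (\<phi> i))" by simp
  have "e i \<noteq> 0"
  proof
    assume "e i = 0"
    have "(\<Sum>i<r. e i * degree (\<phi> i)) < (\<Sum>i<r. degree (\<phi> i))"
    proof (rule sum_strict_mono_ex1)
      show "\<forall>k\<in>{..<r}. e k * degree (\<phi> k) \<le> degree (\<phi> k)"
        using e_le by (metis mult_le_mono1 mult_1)
      show "\<exists>k\<in>{..<r}. e k * degree (\<phi> k) < degree (\<phi> k)"
        using i \<open>e i = 0\<close> phi_deg[OF i] by (intro bexI[of _ i]) auto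
    qed simp
    thus False using eq by simp
  qed
  hence "{j. j < s \<and> i \<in> S j} \<noteq> {}" unfolding e_def by (metis card.empty)
  thus ?thesis using that by blast
qed

lemma degree_Phi:
  assumes "i < r"
  shows "degree (\<Phi> i) < degree f"
proof -
  have "degree (\<Phi> i) \<le> degree (\<Prod>k\<in>{..<r} - {i}. \<phi> k) + degree (pderiv (\<phi> i))"
    unfolding \<Phi>_def by (rule order.trans[OF degree_smult_le degree_mult_le])
  also have "\<dots> = (\<Sum>k\<in>{..<r} - {i}. degree (\<phi> k)) + (degree (\<phi> i) - 1)"
    by (simp add: degree_prod_phi degree_pderiv)
  also have "\<dots> < (\<Sum>k\<in>{..<r} - {i}. degree (\<phi> k)) + degree (\<phi> i)"
    using phi_deg[OF assms] by simp
  also have "\<dots> = degree f"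
    unfolding degree_f using assms by (simp add: sum.remove[of "{..<r}" i])
  finally show ?thesis .
qed

section \<open>Constancy on blocks by the resultant\<close>

text \<open>\<open>H\<close> is lattice membership of (x, y) in polynomial form, and
  \<open>small\<close> is the LLL bound on its squared length.\<close>

lemma block_constant:
  fixes x y :: "nat \<Rightarrow> int" and B' :: real
  defines "n \<equiv> degree f" and "A \<equiv> poly_norm f"
  assumes n: "n \<ge> 2"
    and H: "[:m:] dvd (\<Sum>k<n. monom (y k) k) - (\<Sum>k<r. smult (x k) (\<Phi> k))"
    and B': "B' \<ge> 2 ^ (n - 1) * real n * A"
    and m: "real_of_int m > (A * (2 ^ (n - 1) + real n) * B' * (1 + B')) ^ n"
    and small: "(\<Sum>k<r. (real_of_int (x k))\<^sup>2) + (\<Sum>k<n. (real_of_int (y k))\<^sup>2) \<le> 2 ^ (2 * n - 1) * B'\<^sup>2"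
    and j: "j < s" and i: "i \<in> S j" "i' \<in> S j"
  shows "x i = x i'"
proof (rule ccontr)
  assume ne: "x i \<noteq> x i'"
  define H where "H = (\<Sum>k<n. monom (y k) k)"
  define q where "q = (2::real) ^ (n - 1)"
  \<comment> \<open>M is the root of the bound in \<open>small\<close>, so it bounds the length of
    (x, y) and every single entry.\<close>
  define M where "M = sqrt 2 * q * B'"
  define K where "K = A * (q + real n) * B' * (1 + B')"
  have ir: "i < r" "i' < r" using S_subset[OF j] i by auto
  have "f \<noteq> 0" using n by (auto simp: n_def)
  hence A: "A \<ge> 1" unfolding A_def by (rule poly_norm_ge_1)
  have q: "q \<ge> 1" by (simp add: q_def)
  have qn: "q * real n \<le> q * real n * A" using q A mult_left_mono[of 1 A "q * real n"] by simp
  have B'q: "B' \<ge> q * real n" using qn B' unfolding q_def by linarith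
  have "q * 2 \<le> q * real n" using q n by (intro mult_left_mono) auto
  hence B'2: "B' \<ge> 2 * q" using B'q by simp
  hence B'0: "B' \<ge> 2" using q by simp
  have M0: "M \<ge> 0" using q B'0 by (simp add: M_def)
  have M_sq: "M\<^sup>2 = 2 ^ (2 * n - 1) * B'\<^sup>2"
  proof -
    have "2 * n - 1 = Suc ((n - 1) + (n - 1))" using n by simp
    hence "(2::real) ^ (2 * n - 1) = 2 * (q * q)" by (simp only: q_def power_Suc power_add)
    thus ?thesis by (simp add: M_def power_mult_distrib power2_eq_square)
  qed
  have pow: "K ^ n < real_of_int m" using m by (simp add: K_def q_def)
  have x_le: "\<bar>real_of_int (x k)\<bar> \<le> M" if "k < r" for k
  proof (rule power2_le_imp_le)
    have "(real_of_int (x k))\<^sup>2 \<le> (\<Sum>k<r. (real_of_int (x k))\<^sup>2)"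
      using that by (intro member_le_sum) auto
    also have "\<dots> \<le> (\<Sum>k<r. (real_of_int (x k))\<^sup>2) + (\<Sum>k<n. (real_of_int (y k))\<^sup>2)"
      by (simp add: sum_nonneg)
    finally show "\<bar>real_of_int (x k)\<bar>\<^sup>2 \<le> M\<^sup>2" using small by (simp add: M_sq)
  qed (rule M0)
  have K_2M: "2 * M \<le> K"
  proof -
    have "sqrt 2 \<le> 2" by (rule real_le_lsqrt) auto
    hence "2 * M \<le> 2 * (2 * q * B')"
      using q B'0 unfolding M_def by (intro mult_left_mono mult_right_mono) auto
    also have "\<dots> = 1 * (1 + 1) * B' * (2 * q)" by simp
    also have "\<dots> \<le> A * (q + real n) * B' * (1 + B')"
      using A q n B'2 B'0 by (intro mult_mono) auto
    finally show ?thesis by (simp add: K_def)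
  qed
  have K1: "K \<ge> 1"
  proof -
    have "1 * (1 + 0) * 1 * (1 + 0) \<le> A * (q + real n) * B' * (1 + B')"
      using A q B'0 by (intro mult_mono add_mono) auto
    thus ?thesis by (simp add: K_def)
  qed
  \<comment> \<open>Two entries differ by at most 2M, which is below m; being distinct they stay
    distinct modulo m.\<close>
  have not_cong: "\<not> m dvd x i' - x i"
  proof
    assume "m dvd x i' - x i"
    hence "\<bar>m\<bar> \<le> \<bar>x i' - x i\<bar>" using ne by (intro dvd_imp_le_int) auto
    hence "real_of_int m \<le> \<bar>real_of_int (x i') - real_of_int (x i)\<bar>" by linarith
    also have "\<dots> \<le> 2 * M" using x_le[OF ir(1)] x_le[OF ir(2)] by linarith
    also have "\<dots> \<le> K ^ 1" using K_2M by simp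
    also have "\<dots> \<le> K ^ n" using K1 n by (intro power_increasing) auto
    finally show False using pow by simp
  qed
  obtain k P where k: "k < s"
    and P: "P = H - smult (x i) (pderiv f) + smult (int k) (G j * pderiv (Q j))"
    and cop: "coprime (of_int_poly f :: rat poly) (of_int_poly P)"
    and modulus: "\<And>R u w. [:R:] = u * f + w * P \<Longrightarrow> m dvd R"
    by (rule ex_coprime_shift[OF j i not_cong H[folded H_def]], rule that, assumption+)
  have fQG: "f = Q j * G j" using f_eq[OF j] by (simp add: mult.commute)
  have n1: "degree f \<ge> 1" using n by (simp add: n_def)
  have degH: "degree H < n"
    unfolding H_def using n by (intro degree_sum_less) (auto intro: le_less_trans[OF degree_monom_le])
  have deg_f': "degree (pderiv f) < n" using n by (simp add: n_def degree_pderiv)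
  have deg_GQ: "degree (G j * pderiv (Q j)) < n"
    using degree_log_deriv[OF fQG n1] by (simp add: n_def mult.commute)
  have degP: "degree P < n"
    unfolding P using degH deg_f' deg_GQ
    by (intro degree_add_less degree_diff_less le_less_trans[OF degree_smult_le])
  define h where "h = poly_norm H"
  have h: "h\<^sup>2 = (\<Sum>k<n. (real_of_int (y k))\<^sup>2)"
  proof -
    have "coeff H k = y k" if "k < n" for k
      using that by (simp add: H_def coeff_sum sum.delta)
    thus ?thesis unfolding h_def poly_norm_eq_L2_set[OF degH] L2_set_def by (simp add: sum_nonneg)
  qed
  have "poly_norm P \<le> h + \<bar>real_of_int (x i)\<bar> * poly_norm (pderiv f)
      + real k * poly_norm (G j * pderiv (Q j))"
  proof -
    have "P = H + smult (- x i) (pderiv f) + smult (int k) (G j * pderiv (Q j))" by (simp add: P)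
    thus ?thesis
      using poly_norm_add[of "H + smult (- x i) (pderiv f)" "smult (int k) (G j * pderiv (Q j))"]
        poly_norm_add[of H "smult (- x i) (pderiv f)"]
      by (simp only: poly_norm_smult h_def) simp
  qed
  also have "\<dots> \<le> h + \<bar>real_of_int (x i)\<bar> * (real n * A) + (real n - 1) * B'"
  proof (intro add_mono order.refl mult_mono)
    show "poly_norm (pderiv f) \<le> real n * A"
      unfolding n_def A_def by (rule poly_norm_pderiv_le)
    show "real k \<le> real n - 1" using k s_le_degree by (simp add: n_def)
    show "poly_norm (G j * pderiv (Q j)) \<le> B'"
      using poly_norm_log_deriv_le[OF fQG n1] B' by (simp add: n_def A_def mult.commute)
  qed (use n in \<open>auto simp: poly_norm_nonneg\<close>)
  \<comment> \<open>Cauchy--Schwarz for (h, |x_i|) and (1, nA). Bounding h and x_i jointly by M,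
    instead of each by M, keeps the constant within reach of the hypothesis.\<close>
  also have "h + \<bar>real_of_int (x i)\<bar> * (real n * A) \<le> M * sqrt (1 + (real n * A)\<^sup>2)"
  proof (rule power2_le_imp_le)
    have "(h + \<bar>real_of_int (x i)\<bar> * (real n * A))\<^sup>2
        \<le> (h\<^sup>2 + \<bar>real_of_int (x i)\<bar>\<^sup>2) * (1 + (real n * A)\<^sup>2)"
      using zero_le_power2[of "\<bar>real_of_int (x i)\<bar> - h * (real n * A)"]
      by (simp add: power2_eq_square algebra_simps)
    also have "\<dots> \<le> M\<^sup>2 * (1 + (real n * A)\<^sup>2)"
    proof (rule mult_right_mono)
      have "(real_of_int (x i))\<^sup>2 \<le> (\<Sum>k<r. (real_of_int (x k))\<^sup>2)"
        using ir by (intro member_le_sum) auto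
      thus "h\<^sup>2 + \<bar>real_of_int (x i)\<bar>\<^sup>2 \<le> M\<^sup>2" using small by (simp add: M_sq h)
    qed simp
    finally show "(h + \<bar>real_of_int (x i)\<bar> * (real n * A))\<^sup>2 \<le> (M * sqrt (1 + (real n * A)\<^sup>2))\<^sup>2"
      by (simp add: power_mult_distrib)
  qed (simp add: M0)
  finally have normP: "poly_norm P \<le> M * sqrt (1 + (real n * A)\<^sup>2) + (real n - 1) * B'" by simp
  define X where "X = sqrt (real n) * (M * sqrt (1 + (real n * A)\<^sup>2) + (real n - 1) * B')"
  have norm1P: "real_of_int (poly_norm1 P) \<le> X"
  proof -
    have "real_of_int (poly_norm1 P) \<le> sqrt (real (degree P) + 1) * poly_norm P" by (rule poly_norm1_le)
    also have "\<dots> \<le> X"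
      unfolding X_def using degP normP by (intro mult_mono) (auto simp: poly_norm_nonneg)
    finally show ?thesis .
  qed
  have norm1f: "real_of_int (poly_norm1 f) \<le> sqrt (real n + 1) * A"
    unfolding n_def A_def by (rule poly_norm1_le)
  have "1 * 1 \<le> sqrt (real n + 1) * A" using A by (intro mult_mono) auto
  hence a1: "1 \<le> sqrt (real n + 1) * A" by simp
  define R where "R = resultant f P"
  have "\<bar>real_of_int R\<bar> = real_of_int \<bar>R\<bar>" by simp
  also have "\<dots> \<le> real_of_int (poly_norm1 f ^ degree P * poly_norm1 P ^ degree f)"
    unfolding R_def of_int_le_iff by (rule abs_resultant_le)
  also have "\<dots> = real_of_int (poly_norm1 f) ^ degree P * real_of_int (poly_norm1 P) ^ n"
    by (simp add: n_def)
  also have "\<dots> \<le> (sqrt (real n + 1) * A) ^ degree P * X ^ n"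
    using norm1f norm1P a1 poly_norm1_nonneg[of f] poly_norm1_nonneg[of P]
    by (intro mult_mono power_mono) auto
  also have "\<dots> \<le> (sqrt (real n + 1) * A) ^ (n - 1) * X ^ n"
  proof (rule mult_right_mono)
    show "(sqrt (real n + 1) * A) ^ degree P \<le> (sqrt (real n + 1) * A) ^ (n - 1)"
      using a1 degP by (intro power_increasing) auto
    have "0 \<le> X" using norm1P poly_norm1_nonneg[of P] by (meson of_int_0_le_iff order.trans)
    thus "0 \<le> X ^ n" by simp
  qed
  also have "\<dots> \<le> K ^ n"
    unfolding X_def M_def K_def q_def by (rule resultant_size_bound[OF n A B'])
  also have "\<dots> < real_of_int m" by (rule pow)
  finally have "\<bar>R\<bar> < m" by linarith
  moreover have "R \<noteq> 0"
    unfolding R_def resultant_0_gcd using degree_gcd_eq_0_of_coprime[OF cop] by simp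
  moreover have "m dvd R"
  proof -
    have "degree f > 0 \<or> degree P > 0" using n1 by auto
    then obtain u w where "[:resultant f P:] = u * f + w * P"
      by (rule resultant_in_ideal)
    thus ?thesis unfolding R_def by (rule modulus)
  qed
  ultimately show False using dvd_imp_le_int[of R m] by linarith
qed

lemma lattice_vector_cong:
  assumes a: "\<And>i k. i < r \<Longrightarrow> k < degree f \<Longrightarrow> m dvd a k i - coeff (\<Phi> i) k"
    and x: "\<And>k. k < degree f \<Longrightarrow> m dvd x (r + k) - (\<Sum>i<r. x i * a k i)"
  shows "[:m:] dvd (\<Sum>k<degree f. monom (x (r + k)) k) - (\<Sum>i<r. smult (x i) (\<Phi> i))"
  unfolding const_poly_dvd_iff
proof
  fix k
  have L: "coeff (\<Sum>k<degree f. monom (x (r + k)) k) k = (if k < degree f then x (r + k) else 0)"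
    by (simp add: coeff_sum)
  show "m dvd coeff ((\<Sum>k<degree f. monom (x (r + k)) k) - (\<Sum>i<r. smult (x i) (\<Phi> i))) k"
  proof (cases "k < degree f")
    case True
    have "x (r + k) - (\<Sum>i<r. x i * coeff (\<Phi> i) k)
        = (x (r + k) - (\<Sum>i<r. x i * a k i)) + (\<Sum>i<r. x i * (a k i - coeff (\<Phi> i) k))"
      by (simp add: right_diff_distrib sum_subtractf)
    also have "m dvd \<dots>"
      using x[OF True] a[OF _ True] by (intro dvd_add dvd_sum dvd_mult) auto
    finally show ?thesis using True L by (simp add: coeff_sum)
  next
    case False
    hence "coeff (\<Phi> i) k = 0" if "i < r" for i
      using degree_Phi[OF that] by (intro coeff_eq_0) auto
    thus ?thesis using False L by (simp add: coeff_sum)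
  qed
qed

lemma block_vector_cong:
  assumes a: "\<And>i k. i < r \<Longrightarrow> k < degree f \<Longrightarrow> m dvd a k i - coeff (\<Phi> i) k"
    and j: "j < s" and k: "k < degree f"
  shows "m dvd coeff (pderiv (G j) * Q j) k - (\<Sum>i<r. (if i \<in> S j then 1 else 0) * a k i)"
proof -
  have "(\<Sum>i<r. (if i \<in> S j then 1 else 0) * a k i) = (\<Sum>i\<in>S j. a k i)"
    using S_subset[OF j] by (intro sum.mono_neutral_cong_right) auto
  hence "coeff (pderiv (G j) * Q j) k - (\<Sum>i<r. (if i \<in> S j then 1 else 0) * a k i)
      = (coeff (pderiv (G j) * Q j - (\<Sum>i\<in>S j. \<Phi> i)) k) - (\<Sum>i\<in>S j. a k i - coeff (\<Phi> i) k)"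
    by (simp add: coeff_sum sum_subtractf)
  also have "m dvd \<dots>"
  proof (rule dvd_diff)
    show "m dvd coeff (pderiv (G j) * Q j - (\<Sum>i\<in>S j. \<Phi> i)) k"
      using log_deriv_cong[OF j] unfolding const_poly_dvd_iff by blast
    show "m dvd (\<Sum>i\<in>S j. a k i - coeff (\<Phi> i) k)"
      by (rule dvd_sum) (use S_subset[OF j] a[OF _ k] in blast)
  qed
  finally show ?thesis .
qed

end

section \<open>The all-coefficients lattice\<close>

lemma pcong_iff_dvd: "pcong m p q \<longleftrightarrow> [:m:] dvd p - q"
  by (simp add: pcong_def const_poly_dvd_iff cong_iff_dvd_diff)

lemma const_poly_dvd_prod_diff:
  fixes p q :: "'a \<Rightarrow> int poly"
  assumes "\<And>i. i \<in> A \<Longrightarrow> [:m:] dvd p i - q i"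
  shows "[:m:] dvd prod p A - prod q A"
  using assms
proof (induction A rule: infinite_finite_induct)
  case (insert x A)
  have "prod p (insert x A) - prod q (insert x A) = p x * (prod p A - prod q A) + (p x - q x) * prod q A"
    using insert.hyps by (simp add: algebra_simps)
  also have "[:m:] dvd \<dots>"
    using insert by (intro dvd_add[OF dvd_mult dvd_mult2]) auto
  finally show ?case .
qed auto

text \<open>\<open>F l\<close> is monic of degree d only up to multiples of \<open>v^l\<close>, so
  it is cut off below d and completed by X^d. If d were 0, all higher coefficients would vanish at
  every level, against nonconstancy.\<close>

lemma zmonic_approx:
  assumes "zmonic v F" "zp_nonconst v F"
  obtains p where "monic p" "degree p \<ge> 1" "[:int v ^ l:] dvd F l - p"
proof -
  obtain d where d: "\<And>k. [coeff (F k) d = 1] (mod int v ^ k)"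
    "\<And>k j. j > d \<Longrightarrow> [coeff (F k) j = 0] (mod int v ^ k)"
    using assms(1) unfolding zmonic_def by blast
  obtain j k where jk: "j \<ge> 1" "\<not> int v ^ k dvd coeff (F k) j"
    using assms(2) unfolding zp_nonconst_def by blast
  have "d \<ge> 1"
  proof (rule ccontr)
    assume "\<not> d \<ge> 1"
    hence "[coeff (F k) j = 0] (mod int v ^ k)" using jk(1) by (intro d(2)) auto
    thus False using jk(2) by (simp add: cong_0_iff)
  qed
  define p where "p = poly_cutoff d (F l) + monom 1 d"
  have coeff_p: "coeff p i = (if i < d then coeff (F l) i else if i = d then 1 else 0)" for i
    by (simp add: p_def coeff_poly_cutoff)
  have "degree p = d"
  proof (rule antisym)
    show "degree p \<le> d" by (rule degree_le) (simp add: coeff_p)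
    show "d \<le> degree p" by (rule le_degree) (simp add: coeff_p)
  qed
  moreover have "int v ^ l dvd coeff (F l) i - coeff p i" for i
    using d(1)[of l] d(2)[of i l]
    by (cases i d rule: linorder_cases) (auto simp: coeff_p cong_iff_dvd_diff)
  ultimately show ?thesis
    using that[of p] \<open>d \<ge> 1\<close> by (simp add: const_poly_dvd_iff coeff_p)
qed

lemma of_int_mod_ring_eq_0_iff: "(of_int x :: 'p::prime_card mod_ring) = 0 \<longleftrightarrow> int CARD('p) dvd x"
proof -
  have "to_int_mod_ring (of_int_mod_ring x :: 'p mod_ring) = x mod int CARD('p)"
    by transfer simp
  thus ?thesis
    by (metis of_int_of_int_mod_ring of_int_mod_ring_to_int_mod_ring of_int_mod_ring_hom.hom_zero
        dvd_eq_mod_eq_0 of_int_0 to_int_mod_ring_hom.hom_zero)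
qed

text \<open>A Bezout identity modulo \<open>v\<close> has error term \<open>e\<close> divisible by \<open>v\<close>; multiplying it by
  \<open>1 + e + \<dots> + e\<^sup>l\<^sup>-\<^sup>1\<close> turns the error into \<open>e\<^sup>l\<close>.\<close>
lemma coprime_mod_ring_imp_bezout:
  fixes f g :: "int poly"
  assumes "coprime (of_int_poly f :: 'p::prime_card mod_ring poly) (of_int_poly g)"
  shows "\<exists>p q. [:int CARD('p) ^ l:] dvd f * p + g * q - 1"
proof -
  let ?F = "of_int_poly :: int poly \<Rightarrow> 'p mod_ring poly"
  define lift where "lift = (map_poly to_int_mod_ring :: 'p mod_ring poly \<Rightarrow> int poly)"
  have lift: "?F (lift p) = p" for p
    by (rule poly_eqI) (simp add: lift_def coeff_map_poly of_int_of_int_mod_ring)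
  obtain p q where pq: "p * ?F f + q * ?F g = 1"
    using bezout_coefficients_fst_snd[of "?F f" "?F g"] assms by (metis coprime_iff_gcd_eq_1)
  define e where "e = 1 - (f * lift p + g * lift q)"
  have "?F e = 1 - (p * ?F f + q * ?F g)"
    by (simp add: e_def hom_distribs lift mult.commute)
  hence "?F e = 0" using pq by simp
  hence "(of_int (coeff e i) :: 'p mod_ring) = 0" for i
    by (metis coeff_0 of_int_hom.coeff_map_poly_hom)
  hence "[:int CARD('p):] dvd e"
    by (simp add: const_poly_dvd_iff of_int_mod_ring_eq_0_iff)
  hence "[:int CARD('p):] ^ l dvd e ^ l" by (rule dvd_power_same)
  hence "[:int CARD('p) ^ l:] dvd e ^ l" by (simp add: poly_const_pow)
  hence "[:int CARD('p) ^ l:] dvd - (e ^ l)" by simp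
  also have "- (e ^ l) = (1 - e) * (\<Sum>i<l. e ^ i) - 1"
    using one_diff_power_eq[of e l] by (simp add: algebra_simps)
  also have "\<dots> = f * (lift p * (\<Sum>i<l. e ^ i)) + g * (lift q * (\<Sum>i<l. e ^ i)) - 1"
    by (simp add: e_def algebra_simps)
  finally show ?thesis by blast
qed

lemma primitive_int_multiple:
  fixes g :: "rat poly"
  assumes "monic g"
  obtains G :: "int poly" where "content G = 1" "of_int_poly G = smult (of_int (lead_coeff G)) g"
proof -
  obtain d and q :: "int poly" where d: "d > 0" and q: "of_int_poly q = smult (of_int d) g"
    by (rule rat_poly_clear_denominators)
  have "g \<noteq> 0" using assms by auto
  hence "(of_int_poly q :: rat poly) \<noteq> 0" using d q by simp
  hence "q \<noteq> 0" by auto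
  define G where "G = primitive_part q"
  define e where "e = rat_of_int d / rat_of_int (content q)"
  have "content q \<noteq> 0" using \<open>q \<noteq> 0\<close> by simp
  have "smult (rat_of_int (content q)) (of_int_poly G) = of_int_poly (smult (content q) G)"
    by (simp only: of_int_hom.map_poly_hom_smult)
  also have "\<dots> = smult (of_int d) g" by (simp add: G_def q)
  finally have "smult (inverse (rat_of_int (content q))) (smult (rat_of_int (content q)) (of_int_poly G))
      = smult (inverse (rat_of_int (content q))) (smult (of_int d) g)" by simp
  hence G: "of_int_poly G = smult e g"
    using \<open>content q \<noteq> 0\<close> by (simp add: e_def field_simps)
  have "rat_of_int (lead_coeff G) = lead_coeff (of_int_poly G)" by simp
  also have "\<dots> = e" using G assms by simp
  finally have "of_int_poly G = smult (of_int (lead_coeff G)) g" using G by simp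
  moreover have "content G = 1" using \<open>q \<noteq> 0\<close> by (simp add: G_def)
  ultimately show ?thesis using that by blast
qed

text \<open>The denominators allowed by \<open>rat_vcong\<close> are prime to v and therefore cancel
  modulo \<open>v^k\<close>.\<close>

lemma rat_eq_z_imp_dvd:
  assumes "rat_eq_z v g F" "of_int_poly G = smult (of_int D) g"
  shows "[:int v ^ k:] dvd G - smult D (F k)"
  unfolding const_poly_dvd_iff
proof
  fix i
  obtain c d where d: "coprime d (int v)"
    and eq: "of_int d * (coeff g i - of_int (coeff (F k) i)) = of_int (int v ^ k * c)"
    using assms(1) unfolding rat_eq_z_def rat_vcong_def by blast
  have Gi: "rat_of_int (coeff G i) = of_int D * coeff g i"
    using arg_cong[OF assms(2), of "\<lambda>p. coeff p i"] by simp
  have "rat_of_int (d * (coeff G i - D * coeff (F k) i))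
      = of_int D * (of_int d * (coeff g i - of_int (coeff (F k) i)))"
    by (simp add: Gi algebra_simps)
  also have "\<dots> = rat_of_int (int v ^ k * (c * D))" unfolding eq by simp
  finally have "d * (coeff G i - D * coeff (F k) i) = int v ^ k * (c * D)" by (simp only: of_int_eq_iff)
  hence "int v ^ k dvd d * (coeff G i - D * coeff (F k) i)" by simp
  moreover have "coprime (int v ^ k) d" using d by (simp add: coprime_commute)
  ultimately show "int v ^ k dvd coeff (G - smult D (F k)) i"
    by (simp add: coprime_dvd_mult_right_iff)
qed

section \<open>Membership in the lattice and the index t\<close>

lemma sum_lessThan_add:
  fixes r n :: nat
  shows "(\<Sum>i<r + n. h i) = (\<Sum>i<r. h i) + (\<Sum>k<n. h (r + k) :: 'a :: comm_monoid_add)"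
  by (induction n) (auto simp: add.assoc)

lemma sum_all_coeff_gen:
  "(\<Sum>j<r + n. c j * all_coeff_gen v l r n a j i) =
     (if i < r then c i
      else if i < r + n then (\<Sum>j<r. c j * a (i - r) j) + c i * int v ^ l else 0)"
proof -
  have 1: "(\<Sum>j<r. c j * all_coeff_gen v l r n a j i) =
      (if i < r then c i else if i < r + n then \<Sum>j<r. c j * a (i - r) j else 0)"
  proof (cases "i < r")
    case True
    have "(\<Sum>j<r. c j * all_coeff_gen v l r n a j i) = (\<Sum>j<r. if i = j then c j else 0)"
      using True by (intro sum.cong refl) (simp add: all_coeff_gen_def)
    thus ?thesis using True by simp
  qed (simp add: all_coeff_gen_def)
  have 2: "(\<Sum>k<n. c (r + k) * all_coeff_gen v l r n a (r + k) i) =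
      (if i < r then 0 else if i < r + n then c i * int v ^ l else 0)"
  proof -
    have "(\<Sum>k<n. c (r + k) * all_coeff_gen v l r n a (r + k) i)
        = (\<Sum>k<n. if k = i - r then if r \<le> i then c i * int v ^ l else 0 else 0)"
      by (intro sum.cong refl) (auto simp: all_coeff_gen_def)
    thus ?thesis by auto
  qed
  show ?thesis unfolding sum_lessThan_add 1 2 by simp
qed

text \<open>The identity block makes the first r coordinates equal to the coefficients of the first
  r columns; the other coordinates are then determined modulo \<open>v^l\<close>.\<close>

lemma int_span_all_coeff_gen_iff:
  "x \<in> int_span (r + n) (all_coeff_gen v l r n a) \<longleftrightarrow>
     (\<forall>i\<ge>r + n. x i = 0) \<and> (\<forall>k<n. int v ^ l dvd x (r + k) - (\<Sum>j<r. x j * a k j))"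
    (is "?lhs \<longleftrightarrow> ?rhs")
proof
  assume ?lhs
  then obtain c where x: "x = (\<lambda>i. \<Sum>j<r + n. c j * all_coeff_gen v l r n a j i)"
    unfolding int_span_def by blast
  have "x (r + k) - (\<Sum>j<r. x j * a k j) = c (r + k) * int v ^ l" if "k < n" for k
    using that unfolding x sum_all_coeff_gen by simp
  thus ?rhs unfolding x sum_all_coeff_gen by simp
next
  assume rhs: ?rhs
  define c where "c i = (if i < r then x i
    else (x i - (\<Sum>j<r. x j * a (i - r) j)) div int v ^ l)" for i
  have "x = (\<lambda>i. \<Sum>j<r + n. c j * all_coeff_gen v l r n a j i)"
  proof
    fix i
    consider "i < r" | k where "k < n" "i = r + k" | "i \<ge> r + n"
      by (metis add_diff_inverse_nat add_less_cancel_left not_le)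
    thus "x i = (\<Sum>j<r + n. c j * all_coeff_gen v l r n a j i)"
      unfolding sum_all_coeff_gen
    proof cases
      case (2 k)
      have "c i * int v ^ l = x (r + k) - (\<Sum>j<r. x j * a k j)"
        using rhs 2 by (simp add: c_def)
      moreover have "(\<Sum>j<r. c j * a k j) = (\<Sum>j<r. x j * a k j)" by (simp add: c_def)
      ultimately show "x i = (if i < r then c i
          else if i < r + n then (\<Sum>j<r. c j * a (i - r) j) + c i * int v ^ l else 0)"
        using 2 by simp
    qed (use rhs in \<open>simp_all add: c_def\<close>)
  qed
  thus ?lhs unfolding int_span_def by blast
qed

lemma LLL_reduced_short_span:
  fixes b :: "nat \<Rightarrow> nat \<Rightarrow> int"
  defines "rb \<equiv> \<lambda>j i. real_of_int (b j i)"
  assumes red: "LLL_reduced N rb" and C: "C \<ge> 0"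
    and t: "t = (LEAST t. \<forall>j. t \<le> j \<and> j < N \<longrightarrow> vnorm N (gso N rb j) > C)"
  shows LLL_short_vector_in_span:
      "x \<in> int_span N b \<Longrightarrow> vnorm N (\<lambda>i. real_of_int (x i)) \<le> C \<Longrightarrow> x \<in> int_span t b"
    and LLL_short_basis: "j < t \<Longrightarrow> ip N (rb j) (rb j) \<le> 2 ^ (N - 1) * C\<^sup>2"
    and LLL_short_le: "t \<le> N"
proof -
  let ?P = "\<lambda>t. \<forall>j. t \<le> j \<and> j < N \<longrightarrow> vnorm N (gso N rb j) > C"
  have "?P N" by auto
  hence Pt: "?P t" and tN: "t \<le> N" unfolding t by (rule LeastI, rule Least_le)
  show "t \<le> N" by (rule tN)
  show "x \<in> int_span t b" if x: "x \<in> int_span N b" "vnorm N (\<lambda>i. real_of_int (x i)) \<le> C"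
  proof -
    obtain c where c: "x = (\<lambda>i. \<Sum>j<N. c j * b j i)" using x(1) unfolding int_span_def by blast
    have "c j = 0" if "t \<le> j" "j < N" for j
      using short_vector_coeffs_eq_0[of t N C b c j] Pt C x(2) that unfolding rb_def c by blast
    hence "(\<Sum>j<N. c j * b j i) = (\<Sum>j<t. c j * b j i)" for i
      using tN by (intro sum.mono_neutral_right) auto
    thus ?thesis unfolding c int_span_def by auto
  qed
  show "ip N (rb j) (rb j) \<le> 2 ^ (N - 1) * C\<^sup>2" if j: "j < t"
  proof -
    \<comment> \<open>With 0-based indices t is the number of vectors kept. Minimality of t means
      that the last kept Gram--Schmidt vector, at t - 1, is not longer than C.\<close>
    have "\<not> ?P (t - 1)" unfolding t
      by (rule not_less_Least) (use j t in auto)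
    then obtain k where k: "t - 1 \<le> k" "k < N" "\<not> vnorm N (gso N rb k) > C" by blast
    hence "k = t - 1" using Pt j by (cases "t \<le> k") auto
    hence le: "vnorm N (gso N rb (t - 1)) \<le> C" using k by simp
    hence gso: "ip N (gso N rb (t - 1)) (gso N rb (t - 1)) \<le> C\<^sup>2"
      unfolding vnorm_def by (rule sqrt_le_D)
    have "ip N (rb j) (rb j) \<le> 2 ^ (t - 1) * ip N (gso N rb (t - 1)) (gso N rb (t - 1))"
      using j tN by (intro LLL_reduced_basis_bound red) auto
    also have "\<dots> \<le> 2 ^ (N - 1) * C\<^sup>2"
      using tN gso by (intro mult_mono power_increasing) (auto simp: ip_ge_0)
    finally show ?thesis .
  qed
qed

section \<open>The projection of the short sublattice\<close>

theorem theorem4p3: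
  fixes v :: nat and f :: "int poly" and l r s :: nat
    and F :: "nat \<Rightarrow> nat \<Rightarrow> int poly"  \<comment> \<open>F i = v-adic factor f_(i+1), i < r\<close>
    and g :: "nat \<Rightarrow> rat poly"             \<comment> \<open>g j = rational factor g_(j+1), j < s\<close>
    and w :: "nat \<Rightarrow> nat \<Rightarrow> int"            \<comment> \<open>w j i = w_(j+1,i+1)\<close>
    and a :: "nat \<Rightarrow> nat \<Rightarrow> int"            \<comment> \<open>a i j = a_(i,j+1)\<close>
    and b :: "nat \<Rightarrow> nat \<Rightarrow> int"            \<comment> \<open>b j = b_(j+1), j < r+n\<close>
  assumes v_prime: "prime v"
    and card_p: "CARD('p::prime_card) = v"
    and deg: "degree f \<ge> 2"
    and f_sep: "coprime (of_int_poly f :: rat poly) (pderiv (of_int_poly f))"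
    and lc: "\<not> int v dvd lead_coeff f"
    and f_sep_mod: "coprime (of_int_poly f :: 'p mod_ring poly) (pderiv (of_int_poly f))"
    and F_monic: "\<forall>i<r. zmonic v (F i)"
    and F_irred: "\<forall>i<r. irred_Qv v (F i)"
    and F_fact: "zeq v (\<lambda>k. f) (\<lambda>k. smult (lead_coeff f) (\<Prod>i<r. F i k))"
    and g_monic: "\<forall>j<s. monic (g j) \<and> irreducible (g j)"
    and g_fact: "of_int_poly f = smult (of_int (lead_coeff f)) (\<Prod>j<s. g j)"
    and w01: "\<forall>j<s. \<forall>i<r. w j i \<in> {0, 1}"
    and g_w: "\<forall>j<s. rat_eq_z v (g j) (\<lambda>k. \<Prod>i<r. F i k ^ nat (w j i))"
    and l_pos: "l > 0"
    and a_Phi: "\<forall>j<r. \<exists>P. zpoly v P \<and>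
                   zeq v (\<lambda>k. F j k * P k) (\<lambda>k. f * pderiv (F j k)) \<and>
                   (\<forall>i<degree f. [a i j = coeff (P l) i] (mod int v ^ l))"
    and b_basis: "lattice_basis (r + degree f) b (int_span (r + degree f) (all_coeff_gen v l r (degree f) a))"
    and b_LLL: "LLL_reduced (r + degree f) (\<lambda>j i. real_of_int (b j i))"
    and bound: "real v powr (real l / real (degree f)) >
        poly_norm f * (2 ^ (degree f - 1) + real (degree f))
          * sqrt (real r ^ 2 + (2 ^ (degree f - 1) * real (degree f) * poly_norm f) ^ 2)
          * (1 + sqrt (real r ^ 2 + (2 ^ (degree f - 1) * real (degree f) * poly_norm f) ^ 2))"
  shows "proj_first r ` int_span
           (LEAST t. \<forall>j. t \<le> j \<and> j < r + degree f \<longrightarrow>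
              vnorm (r + degree f) (gso (r + degree f) (\<lambda>j i. real_of_int (b j i)) j)
                > sqrt (real r ^ 2 + (2 ^ (degree f - 1) * real (degree f) * poly_norm f) ^ 2)) b
         = int_span s (\<lambda>j i. if i < r then w j i else 0)"
proof -
  define n where "n = degree f"
  define N where "N = r + n"
  define m where "m = int v ^ l"
  define B where "B = 2 ^ (n - 1) * real n * poly_norm f"
  define B' where "B' = sqrt (real r ^ 2 + B ^ 2)"
  define rb where "rb = (\<lambda>j i. real_of_int (b j i))"
  define t where "t = (LEAST t. \<forall>j. t \<le> j \<and> j < N \<longrightarrow> vnorm N (gso N rb j) > B')"
  define S where "S j = {i. i < r \<and> w j i = 1}" for j
  have f0: "f \<noteq> 0" using deg by auto
  have "\<exists>\<phi>. \<forall>i<r. monic (\<phi> i) \<and> degree (\<phi> i) \<ge> 1 \<and> [:m:] dvd F i l - \<phi> i"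
  proof -
    have "\<exists>p. monic p \<and> degree p \<ge> 1 \<and> [:m:] dvd F i l - p" if "i < r" for i
      using zmonic_approx[of v "F i" l] F_monic F_irred that unfolding irred_Qv_def m_def by metis
    thus ?thesis by metis
  qed
  then obtain \<phi> where phi: "\<And>i. i < r \<Longrightarrow> monic (\<phi> i)" "\<And>i. i < r \<Longrightarrow> degree (\<phi> i) \<ge> 1"
    "\<And>i. i < r \<Longrightarrow> [:m:] dvd F i l - \<phi> i" by blast
  have "\<exists>G. \<forall>j<s. content (G j) = 1 \<and> of_int_poly (G j) = smult (of_int (lead_coeff (G j))) (g j)"
  proof -
    have "\<exists>G. content G = 1 \<and> of_int_poly G = smult (of_int (lead_coeff G)) (g j)" if "j < s" for j
      using primitive_int_multiple[of "g j"] g_monic that by metis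
    thus ?thesis by metis
  qed
  then obtain G where G: "\<And>j. j < s \<Longrightarrow> content (G j) = 1"
    "\<And>j. j < s \<Longrightarrow> of_int_poly (G j) = smult (of_int (lead_coeff (G j))) (g j)" by blast
  have G0: "lead_coeff (G j) \<noteq> 0" if "j < s" for j
    using G(1)[OF that] by auto
  have G_dvd: "G j dvd f" if j: "j < s" for j
  proof (rule rat_dvd_imp_int_dvd[OF G(1)[OF j]])
    have "g j dvd (\<Prod>j<s. g j)" using j by (intro dvd_prodI) auto
    hence "g j dvd of_int_poly f" unfolding g_fact by (rule dvd_smult)
    thus "of_int_poly (G j) dvd (of_int_poly f :: rat poly)"
      unfolding G(2)[OF j] using G0[OF j] by (simp add: smult_dvd_iff)
  qed
  define Q where "Q j = f div G j" for j
  define c where "c = rat_of_int (lead_coeff f) / (\<Prod>j<s. rat_of_int (lead_coeff (G j)))"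
  have cop_v: "coprime (int v) d" if "\<not> int v dvd d" for d
    using v_prime that by (simp add: prime_imp_coprime)
  interpret factor_data m f r s \<phi> G Q S c
  proof
    show "[:m:] dvd f - smult (lead_coeff f) (\<Prod>i<r. \<phi> i)"
    proof -
      have 1: "[:m:] dvd f - smult (lead_coeff f) (\<Prod>i<r. F i l)"
        using F_fact unfolding zeq_def pcong_iff_dvd m_def by blast
      have "[:m:] dvd (\<Prod>i<r. F i l) - (\<Prod>i<r. \<phi> i)"
        by (rule const_poly_dvd_prod_diff) (use phi in auto)
      hence "[:m:] dvd smult (lead_coeff f) ((\<Prod>i<r. F i l) - (\<Prod>i<r. \<phi> i))" by (rule dvd_smult)
      from dvd_add[OF 1 this] show ?thesis by (simp add: smult_diff_right)
    qed
    show "coprime (lead_coeff f) m"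
      unfolding m_def using cop_v[OF lc] by (simp add: coprime_commute)
    show "\<not> m dvd 1"
    proof
      assume "m dvd 1"
      moreover have "int v dvd m" unfolding m_def using l_pos by (simp add: dvd_power)
      ultimately have "int v dvd 1" by (rule dvd_trans[rotated])
      thus False using prime_gt_1_nat[OF v_prime] by simp
    qed
    show "\<exists>p q. [:m:] dvd f * p + pderiv f * q - 1"
    proof -
      have "coprime (of_int_poly f :: 'p mod_ring poly) (of_int_poly (pderiv f))"
      proof -
        have "pderiv (of_int_poly f) = (of_int_poly (pderiv f) :: 'p mod_ring poly)"
          by (rule poly_eqI) (simp add: coeff_pderiv)
        thus ?thesis using f_sep_mod by (simp only:)
      qed
      from coprime_mod_ring_imp_bezout[OF this, of l] show ?thesis by (simp only: card_p m_def)
    qed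
    show "[:m:] dvd G j - smult (lead_coeff (G j)) (\<Prod>i\<in>S j. \<phi> i)" if j: "j < s" for j
    proof -
      have "[:m:] dvd G j - smult (lead_coeff (G j)) (\<Prod>i<r. F i l ^ nat (w j i))"
        unfolding m_def using g_w j by (intro rat_eq_z_imp_dvd[of v "g j", where k = l]) (auto simp: G(2))
      also have "(\<Prod>i<r. F i l ^ nat (w j i)) = (\<Prod>i\<in>S j. F i l)"
      proof (rule prod.mono_neutral_cong_right)
        have "w j i = 0" if "i \<in> {..<r} - S j" for i
          using w01 j that by (auto simp: S_def)
        thus "\<forall>i\<in>{..<r} - S j. F i l ^ nat (w j i) = 1" by simp
      qed (auto simp: S_def)
      finally have 1: "[:m:] dvd G j - smult (lead_coeff (G j)) (\<Prod>i\<in>S j. F i l)" .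
      have "[:m:] dvd (\<Prod>i\<in>S j. F i l) - (\<Prod>i\<in>S j. \<phi> i)"
        by (rule const_poly_dvd_prod_diff) (use phi in \<open>auto simp: S_def\<close>)
      hence "[:m:] dvd smult (lead_coeff (G j)) ((\<Prod>i\<in>S j. F i l) - (\<Prod>i\<in>S j. \<phi> i))"
        by (rule dvd_smult)
      from dvd_add[OF 1 this] show ?thesis by (simp add: smult_diff_right)
    qed
    show "irreducible (of_int_poly (G j) :: rat poly)" if j: "j < s" for j
    proof -
      have "is_unit [:rat_of_int (lead_coeff (G j)):]"
        using G0[OF j] by (simp add: is_unit_const_poly_iff)
      hence "irreducible ([:rat_of_int (lead_coeff (G j)):] * g j)"
        using g_monic j by (simp only: irreducible_mult_unit_left)
      thus ?thesis by (subst G(2)[OF j]) simp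
    qed
    show "(of_int_poly f :: rat poly) = smult c (\<Prod>j<s. of_int_poly (G j))"
    proof -
      have "(\<Prod>j<s. of_int_poly (G j) :: rat poly) = (\<Prod>j<s. smult (of_int (lead_coeff (G j))) (g j))"
        using G(2) by (intro prod.cong refl) simp
      also have "\<dots> = smult (\<Prod>j<s. of_int (lead_coeff (G j))) (\<Prod>j<s. g j)"
        by (rule prod_smult)
      finally show ?thesis using G0 by (simp add: g_fact c_def)
    qed
  qed (use phi G f_sep G_dvd in \<open>auto simp: Q_def S_def\<close>)
  have a_Phi_cong: "m dvd a k i - coeff (\<Phi> i) k" if i: "i < r" and k: "k < degree f" for i k
  proof -
    obtain P where P: "pcong m (F i l * P l) (f * pderiv (F i l))" "[a k i = coeff (P l) k] (mod m)"
      using a_Phi i k unfolding zeq_def m_def by blast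
    \<comment> \<open>P is known only through its product with \<open>F i\<close>. Exchanging
      \<open>F i l\<close> for \<open>\<phi> i\<close> costs multiples of m, after which the monic
      \<open>\<phi> i\<close> can be cancelled.\<close>
    have "\<phi> i * (P l - \<Phi> i) = (F i l * P l - f * pderiv (F i l)) - (F i l - \<phi> i) * P l
        + f * pderiv (F i l - \<phi> i) + (f * pderiv (\<phi> i) - \<phi> i * \<Phi> i)"
      by (simp add: pderiv_diff algebra_simps)
    also have "[:m:] dvd \<dots>"
      by (intro dvd_add[OF dvd_add[OF dvd_diff[OF _ dvd_mult2] dvd_mult]] Phi_cong i
          const_poly_dvd_pderiv phi P(1)[unfolded pcong_iff_dvd])
    finally have "[:m:] dvd P l - \<Phi> i"
      using phi(1)[OF i] by (intro monic_cancel_mod[of "\<phi> i"]) (auto simp: const_poly_dvd_iff)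
    hence "m dvd coeff (P l) k - coeff (\<Phi> i) k" by (simp add: const_poly_dvd_iff)
    moreover have "m dvd a k i - coeff (P l) k" using P(2) by (simp add: cong_iff_dvd_diff)
    ultimately have "m dvd (a k i - coeff (P l) k) + (coeff (P l) k - coeff (\<Phi> i) k)" by (intro dvd_add)
    thus ?thesis by simp
  qed
  have n2: "n \<ge> 2" using deg by (simp add: n_def)
  have B0: "B \<ge> 0" by (simp add: B_def poly_norm_nonneg)
  have B'_ge: "B' \<ge> B" unfolding B'_def by (rule real_le_rsqrt) simp
  have B'0: "B' \<ge> 0" using B0 B'_ge by linarith
  have span: "int_span N b = int_span N (all_coeff_gen v l r n a)"
    using b_basis unfolding lattice_basis_def N_def n_def by blast
  have red: "LLL_reduced N rb" using b_LLL by (simp add: N_def n_def rb_def)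
  note short = LLL_reduced_short_span[OF red[unfolded rb_def] B'0 t_def[unfolded rb_def]]
  have m_large: "real_of_int m > (poly_norm f * (2 ^ (n - 1) + real n) * B' * (1 + B')) ^ n"
  proof -
    have v0: "real v > 0" using prime_gt_0_nat[OF v_prime] by simp
    have "(poly_norm f * (2 ^ (n - 1) + real n) * B' * (1 + B')) ^ n
        < (real v powr (real l / real n)) ^ n"
      using bound n2 B'0 by (intro power_strict_mono) (auto simp: n_def B'_def B_def poly_norm_nonneg)
    also have "\<dots> = real v powr (real l / real n * real n)"
      using v0 by (subst powr_realpow[symmetric]) (auto simp: powr_powr)
    also have "\<dots> = real v ^ l" using n2 v0 by (simp add: powr_realpow)
    finally show ?thesis by (simp add: m_def)
  qed

  have const: "b k i = b k i'" if k: "k < t" and j: "j < s" and i: "i \<in> S j" "i' \<in> S j" for k j i i'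
  proof -
    have kN: "k < N" using k short(3) by simp
    have "b k = (\<lambda>i. \<Sum>j<N. (if j = k then 1 else 0) * b j i)"
      using kN by (simp add: if_distrib[of "\<lambda>x. x * _"] cong: if_cong)
    hence "b k \<in> int_span N b"
      unfolding int_span_def by (intro CollectI exI[of _ "\<lambda>j. if j = k then 1 else 0"])
    hence mem: "int v ^ l dvd b k (r + i) - (\<Sum>j<r. b k j * a i j)" if "i < n" for i
      using that unfolding span unfolding N_def int_span_all_coeff_gen_iff by blast
    have "(\<Sum>i<r. (real_of_int (b k i))\<^sup>2) + (\<Sum>i<n. (real_of_int (b k (r + i)))\<^sup>2) = ip N (rb k) (rb k)"
      by (simp add: ip_def N_def sum_lessThan_add rb_def power2_eq_square)
    also have "\<dots> \<le> 2 ^ (N - 1) * B'\<^sup>2" using short(2)[OF k] by (simp add: rb_def)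
    \<comment> \<open>N - 1 = r + n - 1 is at most 2n - 1, because r <= n.\<close>
    also have "\<dots> \<le> 2 ^ (2 * n - 1) * B'\<^sup>2"
      using r_le_degree by (intro mult_right_mono power_increasing) (auto simp: N_def n_def)
    finally have small: "(\<Sum>i<r. (real_of_int (b k i))\<^sup>2) + (\<Sum>i<n. (real_of_int (b k (r + i)))\<^sup>2)
        \<le> 2 ^ (2 * n - 1) * B'\<^sup>2" .
    have H: "[:m:] dvd (\<Sum>i<degree f. monom (b k (r + i)) i) - (\<Sum>i<r. smult (b k i) (\<Phi> i))"
      by (rule lattice_vector_cong[where a = a]) (use mem a_Phi_cong in \<open>auto simp: m_def n_def\<close>)
    show ?thesis
      using block_constant[OF _ H _ _ _ j i, of B'] n2 B'_ge m_large small
      by (simp add: n_def B_def)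
  qed

  have block_vector: "\<exists>z\<in>int_span t b. \<forall>i<r. z i = w j i" if j: "j < s" for j
  proof -
    \<comment> \<open>Scaling g_j does not change its logarithmic derivative, so
      \<open>pderiv (G j) * Q j\<close> is f g_j' / g_j itself, with integer coefficients.\<close>
    define z where "z i = (if i < r then (if i \<in> S j then 1 else 0)
      else if i < r + n then coeff (pderiv (G j) * Q j) (i - r) else 0)" for i
    have z: "z \<in> int_span N b"
      unfolding span unfolding N_def int_span_all_coeff_gen_iff
    proof (intro conjI allI impI)
      fix k assume "k < n"
      hence "int v ^ l dvd coeff (pderiv (G j) * Q j) k - (\<Sum>i<r. (if i \<in> S j then 1 else 0) * a k i)"
        using block_vector_cong[where a = a, OF a_Phi_cong j] by (simp add: n_def m_def)
      thus "int v ^ l dvd z (r + k) - (\<Sum>i<r. z i * a k i)"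
        using \<open>k < n\<close> by (simp add: z_def)
    qed (simp add: z_def)
    have "ip N (\<lambda>i. real_of_int (z i)) (\<lambda>i. real_of_int (z i))
        = (\<Sum>i<r. (real_of_int (z i))\<^sup>2) + (\<Sum>k<n. (real_of_int (coeff (pderiv (G j) * Q j) k))\<^sup>2)"
      by (simp add: ip_def N_def sum_lessThan_add z_def power2_eq_square)
    \<comment> \<open>The 0/1 entries contribute at most r <= r^2 and the coefficients at most B^2,
      which together give the square of B'.\<close>
    also have "\<dots> \<le> (real r)\<^sup>2 + B\<^sup>2"
    proof (rule add_mono)
      have "(\<Sum>i<r. (real_of_int (z i))\<^sup>2) \<le> (\<Sum>i<r. 1)"
        by (intro sum_mono) (simp add: z_def)
      also have "\<dots> \<le> (real r)\<^sup>2"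
        using mult_right_mono[of 1 "real r" "real r"] by (cases "r = 0") (auto simp: power2_eq_square)
      finally show "(\<Sum>i<r. (real_of_int (z i))\<^sup>2) \<le> (real r)\<^sup>2" .
      have "(\<Sum>k<n. (real_of_int (coeff (pderiv (G j) * Q j) k))\<^sup>2)
          = (L2_set (\<lambda>k. real_of_int (coeff (pderiv (G j) * Q j) k)) {..<n})\<^sup>2"
        by (simp add: L2_set_def sum_nonneg)
      also have "\<dots> \<le> B\<^sup>2"
        unfolding B_def using n2
        by (intro power_mono L2_set_log_deriv_le f_eq j L2_set_nonneg) (auto simp: n_def)
      finally show "(\<Sum>k<n. (real_of_int (coeff (pderiv (G j) * Q j) k))\<^sup>2) \<le> B\<^sup>2" .
    qed
    finally have "vnorm N (\<lambda>i. real_of_int (z i)) \<le> B'"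
      unfolding vnorm_def B'_def by (rule real_sqrt_le_mono)
    hence "z \<in> int_span t b" by (rule short(1)[OF z])
    moreover have "z i = w j i" if "i < r" for i
      using that w01 j by (auto simp: z_def S_def)
    ultimately show ?thesis by blast
  qed

  have "proj_first r ` int_span t b = int_span s (\<lambda>j i. if i < r then w j i else 0)"
  proof (intro equalityI subsetI)
    fix y assume "y \<in> proj_first r ` int_span t b"
    then obtain d where d: "y = proj_first r (\<lambda>i. \<Sum>k<t. d k * b k i)" unfolding int_span_def by blast
    \<comment> \<open>A representative of each block: the coefficient of w_j is the value that the
      vector takes on block j, read off at \<open>\<rho> j\<close>.\<close>
    define \<rho> where "\<rho> j = (SOME i. i \<in> S j)" for j
    have rho: "\<rho> j \<in> S j" if "j < s" for j
      unfolding \<rho>_def using S_nonempty[OF that] by (simp add: some_in_eq)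
    have "y = (\<lambda>i. \<Sum>j<s. (\<Sum>k<t. d k * b k (\<rho> j)) * (if i < r then w j i else 0))"
    proof
      fix i
      show "y i = (\<Sum>j<s. (\<Sum>k<t. d k * b k (\<rho> j)) * (if i < r then w j i else 0))"
      proof (cases "i < r")
        case True
        then obtain j0 where j0: "j0 < s" "i \<in> S j0" by (rule blocks_cover)
        have "(\<Sum>j<s. (\<Sum>k<t. d k * b k (\<rho> j)) * (if i < r then w j i else 0))
            = (\<Sum>j<s. if j = j0 then (\<Sum>k<t. d k * b k (\<rho> j0)) else 0)"
        proof (rule sum.cong[OF refl])
          fix j assume "j \<in> {..<s}"
          hence j: "j < s" by simp
          have "w j i = (if j = j0 then 1 else 0)"
            using blocks_disjoint[OF j0(1) j, of i] j0 j w01 True by (auto simp: S_def)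
          thus "(\<Sum>k<t. d k * b k (\<rho> j)) * (if i < r then w j i else 0)
              = (if j = j0 then (\<Sum>k<t. d k * b k (\<rho> j0)) else 0)" using True by simp
        qed
        also have "\<dots> = (\<Sum>k<t. d k * b k (\<rho> j0))" using j0 by simp
        also have "\<dots> = (\<Sum>k<t. d k * b k i)"
          using const[OF _ j0(1) rho[OF j0(1)] j0(2)] by (intro sum.cong refl) simp
        finally show ?thesis using True by (simp add: d proj_first_def)
      qed (simp add: d proj_first_def)
    qed
    thus "y \<in> int_span s (\<lambda>j i. if i < r then w j i else 0)"
      unfolding int_span_def by (intro CollectI exI[of _ "\<lambda>j. \<Sum>k<t. d k * b k (\<rho> j)"])
  next
    fix y assume "y \<in> int_span s (\<lambda>j i. if i < r then w j i else 0)"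
    then obtain d where d: "y = (\<lambda>i. \<Sum>j<s. d j * (if i < r then w j i else 0))"
      unfolding int_span_def by blast
    have "\<exists>e. \<forall>i<r. (\<Sum>k<t. e k * b k i) = w j i" if "j < s" for j
      using block_vector[OF that] unfolding int_span_def by auto
    then obtain e where e: "\<And>j i. j < s \<Longrightarrow> i < r \<Longrightarrow> (\<Sum>k<t. e j k * b k i) = w j i" by metis
    define u where "u i = (\<Sum>k<t. (\<Sum>j<s. d j * e j k) * b k i)" for i
    have "u i = (\<Sum>j<s. d j * w j i)" if "i < r" for i
    proof -
      have "u i = (\<Sum>k<t. \<Sum>j<s. d j * (e j k * b k i))"
        by (simp add: u_def sum_distrib_right mult.assoc)
      also have "\<dots> = (\<Sum>j<s. d j * (\<Sum>k<t. e j k * b k i))"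
        by (subst sum.swap) (simp add: sum_distrib_left)
      also have "\<dots> = (\<Sum>j<s. d j * w j i)" using e that by (intro sum.cong refl) simp
      finally show ?thesis .
    qed
    hence "y = proj_first r u" by (auto simp: d proj_first_def)
    moreover have "u \<in> int_span t b"
      unfolding int_span_def u_def by (intro CollectI exI[of _ "\<lambda>k. \<Sum>j<s. d j * e j k"]) (rule refl)
    ultimately show "y \<in> proj_first r ` int_span t b" by blast
  qed
  thus ?thesis by (simp only: t_def N_def n_def rb_def B'_def B_def)
qed

end
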